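(* Let $\mathcal G$ be a connected unweighted graph on $n$ nodes that has exactly $\kappa(\mathcal G)$ cut edges. Then $$\rho_{ss}(L_{\mathcal G};M_n)\ \ge\ \frac1{2n}+\frac{\kappa(\mathcal G)+1}2-\frac1{n-\kappa(\mathcal G)}.$$ Equality holds if and only if $\mathcal G=\mathcal S(\mathcal K_{n-\kappa(\mathcal G)};\mathcal K_1,\dots,\mathcal K_1)$, i.e. $\mathcal G$ is the star-like graph formed by replacing the center of a star with a clique $\mathcal K_{n-\kappa(\mathcal G)}$.
   Context: Graphs are finite, simple, undirected; equality of graphs is up to isomorphism. A cut edge is an edge whose deletion increases the number of connected components. $\mathcal S(\mathcal K_{n-\kappa};\mathcal K_1,\dots,\mathcal K_1)$ denotes the graph on $n$ nodes obtained from the complete graph $\mathcal K_{n-\kappa}$ by attaching $\kappa$ pendant nodes, all to one and the same node of the clique. $L_{\mathcal G}$ is the graph Laplacian (degree matrix minus adjacency matrix) with eigenvalues $0=\lambda_1<\lambda_2\le\dots\le\lambda_n$, $M_n=I_n-\frac1nJ_n$ is the centering matrix, and $\rho_{ss}(L_{\mathcal G};M_n)=\frac12\sum_{i=2}^n\lambda_i^{-1}$ is the performance measure of the first-order consensus network $\dot x=-L_{\mathcal G}x+\xi$, $y=M_nx$. *)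

theory Defs
  imports
    "Graph_Theory.Graph_Theory"
    "Jordan_Normal_Form.Char_Poly"
    "HOL-Library.Multiset"
begin

text \<open>
  A simple undirected graph is a \<open>pair_graph\<close>: each edge between \<open>u\<close> and \<open>v\<close> is represented by the
  two arcs \<open>(u, v)\<close> and \<open>(v, u)\<close>. The nodes are labelled \<open>0, \<dots>, n - 1\<close>, so that they can index
  matrices.
\<close>

definition delete_edge :: "'a pair_pre_digraph \<Rightarrow> 'a \<Rightarrow> 'a \<Rightarrow> 'a pair_pre_digraph" where
  "delete_edge G u v = G\<lparr>parcs := parcs G - {(u, v), (v, u)}\<rparr>"

text \<open>
  For a symmetric digraph the strongly connected components are the connected components of the
  underlying undirected graph.
\<close>

definition num_components :: "'a pair_pre_digraph \<Rightarrow> nat" where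
  "num_components G = card (pre_digraph.sccs_verts (with_proj G))"

definition cut_edges :: "'a pair_pre_digraph \<Rightarrow> 'a set set" where
  "cut_edges G =
    {{u, v} | u v. (u, v) \<in> parcs G \<and> num_components (delete_edge G u v) > num_components G}"

text \<open>
  The graph on \<open>n\<close> nodes consisting of the complete graph on \<open>0, \<dots>, n - k - 1\<close> and \<open>k\<close> pendant nodes
  \<open>n - k, \<dots>, n - 1\<close>, all attached to node \<open>0\<close>. Meaningful for \<open>k < n\<close>.
\<close>

definition clique_star :: "nat \<Rightarrow> nat \<Rightarrow> nat pair_pre_digraph" where
  "clique_star n k =
    \<lparr>pverts = {0..<n},
     parcs = {(i, j). i < n - k \<and> j < n - k \<and> i \<noteq> j}
           \<union> {(0, j) | j. n - k \<le> j \<and> j < n}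
           \<union> {(i, 0) | i. n - k \<le> i \<and> i < n}\<rparr>"

definition degree_mat :: "nat \<Rightarrow> nat pair_pre_digraph \<Rightarrow> real mat" where
  "degree_mat n G =
    mat n n (\<lambda>(i, j). if i = j then real (out_degree (with_proj G) i) else 0)"

definition adjacency_mat :: "nat \<Rightarrow> nat pair_pre_digraph \<Rightarrow> real mat" where
  "adjacency_mat n G = mat n n (\<lambda>(i, j). if (i, j) \<in> parcs G then 1 else 0)"

definition laplacian :: "nat \<Rightarrow> nat pair_pre_digraph \<Rightarrow> real mat" where
  "laplacian n G = degree_mat n G - adjacency_mat n G"

text \<open>
  The \<open>i\<close>-th smallest real eigenvalue of \<open>A\<close>, counted with algebraic multiplicity, for \<open>i \<ge> 1\<close>.
  A symmetric matrix \<open>A\<close> of dimension \<open>n\<close> has exactly \<open>n\<close> of these.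
\<close>

definition eigval :: "real mat \<Rightarrow> nat \<Rightarrow> real" where
  "eigval A i = sorted_list_of_multiset (proots (char_poly A)) ! (i - 1)"

text \<open>
  The performance measure of the consensus network \<open>x' = - L x + \<xi>\<close>, \<open>y = M x\<close>, where \<open>L\<close> is the
  Laplacian of a connected graph and \<open>M = I - J / n\<close> is the centering matrix.
\<close>

definition rho_ss :: "real mat \<Rightarrow> real" where
  "rho_ss L = (1 / 2) * (\<Sum>i = 2..dim_row L. inverse (eigval L i))"

end

theory Submission
  imports Defs "Jordan_Normal_Form.Schur_Decomposition"
begin

text \<open>
  The sum of the inverse nonzero Laplacian eigenvalues of a connected graph, multiplied by \<open>n\<close>, is its
  Kirchhoff index, the sum of the effective resistances over all pairs of nodes
  (\<open>sum_inverse_eigval\<close>). Hence the performance measure is the Kirchhoff index divided by \<open>2 * n\<close>,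
  and the theorem becomes a statement about resistances. A cut edge is a bridge of the
  resistor network.

  A bridge with ends \<open>a\<close>, \<open>b\<close> splits the graph into sides \<open>A\<close>, \<open>B\<close>. Resistances within one side
  are those of the side alone, and the resistance between \<open>i\<close> in \<open>A\<close> and \<open>j\<close> in \<open>B\<close> is
  \<open>R(i, a) + 1 + R(b, j)\<close>. Write \<open>Kf\<close> for the Kirchhoff index and \<open>far(v)\<close>, the farness of \<open>v\<close>, for the
  sum of the resistances from \<open>v\<close>. Summation gives (\<open>kirchhoff_join\<close>, \<open>farness_left\<close>)

  \<open>Kf(G) = Kf(A) + Kf(B) + |A| |B| + |B| far(a) + |A| far(b)\<close>, and

  \<open>far(v) = far_A(v) + |B| (R(v, a) + 1) + far_B(b)\<close> for \<open>v\<close> in \<open>A\<close>.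

  Therefore lower bounds for both quantities, in terms of the number \<open>n\<close> of nodes and the number \<open>k\<close>
  of bridges, can be proved by induction (\<open>farness_lower_bound\<close>, \<open>kirchhoff_lower_bound\<close>). If there is
  no bridge, every resistance is at least \<open>2 / n\<close>, with equality throughout only in the complete
  graph (\<open>resistance_ge\<close>). In the induction step the numbers \<open>m = n - k\<close> of the two sides satisfy
  \<open>m = m1 + m2 - 1\<close>, and the step reduces to \<open>1 / m1 + 1 / m2 \<le> 1 + 1 / m\<close> and
  \<open>|A| |B| \<ge> n - 1\<close>.

  If the Kirchhoff index is minimal, the bridge carries a single node on one side, and the farness of
  its other end is minimal on the other side. Equality in the bound for the farness of \<open>v\<close> makes every
  bridge lead from \<open>v\<close> to a pendant node and the rest a clique; so \<open>v\<close> is the common neighbour of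
  all pendant nodes. Conversely, the recursion evaluates both quantities for that graph
  (\<open>star_of_clique_values\<close>).
\<close>

section \<open>Effective resistance\<close>

definition net_laplacian :: "('a \<times> 'a) set \<Rightarrow> ('a \<Rightarrow> real) \<Rightarrow> 'a \<Rightarrow> real" where
  "net_laplacian E h v = (\<Sum>w\<in>E `` {v}. h v - h w)"

text \<open>
  The node voltages when a unit current enters the network of unit resistors at \<open>i\<close> and leaves it
  at \<open>j\<close>. The equation is imposed at every element of the type; outside the node set both sides
  vanish, so that no node set has to be mentioned.
\<close>

definition potential :: "('a \<times> 'a) set \<Rightarrow> 'a \<Rightarrow> 'a \<Rightarrow> ('a \<Rightarrow> real) \<Rightarrow> bool" where
  "potential E i j h \<longleftrightarrow> (\<forall>v. net_laplacian E h v = of_bool (v = i) - of_bool (v = j))"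

text \<open>
  The effective resistance. The choice of the potential does not matter, by
  \<open>potential_drop_unique\<close>.
\<close>

definition resistance :: "('a \<times> 'a) set \<Rightarrow> 'a \<Rightarrow> 'a \<Rightarrow> real" where
  "resistance E i j = (let h = (SOME h. potential E i j h) in h i - h j)"

definition farness :: "'a set \<Rightarrow> ('a \<times> 'a) set \<Rightarrow> 'a \<Rightarrow> real" where
  "farness V E v = (\<Sum>i\<in>V. resistance E i v)"

text \<open>
  The Kirchhoff index. Every unordered pair of nodes occurs twice in the double sum.
\<close>

definition kirchhoff :: "'a set \<Rightarrow> ('a \<times> 'a) set \<Rightarrow> real" where
  "kirchhoff V E = (\<Sum>i\<in>V. \<Sum>j\<in>V. resistance E i j) / 2"

definition bridges :: "('a \<times> 'a) set \<Rightarrow> 'a set set" where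
  "bridges E = {{u, v} | u v. (u, v) \<in> E \<and> (u, v) \<notin> (E - {(u, v), (v, u)})\<^sup>*}"

definition star_of_clique :: "'a set \<Rightarrow> ('a \<times> 'a) set \<Rightarrow> 'a \<Rightarrow> 'a set \<Rightarrow> bool" where
  "star_of_clique V E c P \<longleftrightarrow> c \<in> V \<and> P \<subseteq> V \<and> c \<notin> P \<and>
     E = {(x, y). x \<in> V - P \<and> y \<in> V - P \<and> x \<noteq> y} \<union> {c} \<times> P \<union> P \<times> {c}"

lemma sum_mult_of_bool:
  fixes f :: "'a \<Rightarrow> real"
  assumes "finite A" "i \<in> A"
  shows "(\<Sum>v\<in>A. f v * of_bool (v = i)) = f i"
proof -
  have "(\<Sum>v\<in>A. f v * of_bool (v = i)) = (\<Sum>v\<in>A. if v = i then f v else 0)"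
    by (rule sum.cong) auto
  then show ?thesis using assms by simp
qed

locale simple_graph =
  fixes V :: "'a set" and E :: "('a \<times> 'a) set"
  assumes finite_V: "finite V"
    and E_subset: "E \<subseteq> V \<times> V"
    and E_sym: "(x, y) \<in> E \<Longrightarrow> (y, x) \<in> E"
    and E_irrefl: "(x, x) \<notin> E"
begin

lemma finite_E: "finite E"
  using finite_subset[OF E_subset] finite_V by blast

lemma finite_nbrs: "finite (E `` {v})"
  using finite_E by (rule finite_Image)

lemma sum_nbrs_eq_sum_arcs: "(\<Sum>v\<in>V. \<Sum>w\<in>E `` {v}. f v w) = (\<Sum>(v, w)\<in>E. f v w)"
proof -
  have "(\<Sum>v\<in>V. \<Sum>w\<in>E `` {v}. f v w) = (\<Sum>(v, w)\<in>Sigma V (\<lambda>v. E `` {v}). f v w)"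
    by (rule sum.Sigma) (auto simp: finite_V finite_nbrs)
  also have "Sigma V (\<lambda>v. E `` {v}) = E"
    using E_subset by auto
  finally show ?thesis .
qed

lemma sum_arcs_swap: "(\<Sum>(v, w)\<in>E. f v w) = (\<Sum>(v, w)\<in>E. f w v)"
  by (rule sum.reindex_bij_witness[of _ prod.swap prod.swap]) (auto intro: E_sym)

text \<open>
  Green's identity: the two ends of each arc contribute the same amount after the arc is reversed.
  It makes the Laplacian symmetric and turns its quadratic form into a sum of squares.
\<close>

lemma green:
  "(\<Sum>v\<in>V. g v * net_laplacian E h v) = (\<Sum>(v, w)\<in>E. (g v - g w) * (h v - h w)) / 2"
proof -
  have "(\<Sum>v\<in>V. g v * net_laplacian E h v) = (\<Sum>(v, w)\<in>E. g v * (h v - h w))"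
    unfolding net_laplacian_def sum_distrib_left by (rule sum_nbrs_eq_sum_arcs)
  moreover have "(\<Sum>(v, w)\<in>E. g v * (h v - h w)) = (\<Sum>(v, w)\<in>E. g w * (h w - h v))"
    by (rule sum_arcs_swap)
  ultimately have "2 * (\<Sum>v\<in>V. g v * net_laplacian E h v)
      = (\<Sum>(v, w)\<in>E. g v * (h v - h w)) + (\<Sum>(v, w)\<in>E. g w * (h w - h v))"
    by simp
  also have "\<dots> = (\<Sum>(v, w)\<in>E. (g v - g w) * (h v - h w))"
    unfolding sum.distrib[symmetric] by (rule sum.cong) (auto simp: algebra_simps)
  finally show ?thesis by simp
qed

lemma green_commute:
  "(\<Sum>v\<in>V. g v * net_laplacian E h v) = (\<Sum>v\<in>V. h v * net_laplacian E g v)"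
  unfolding green by (simp add: mult.commute)

lemma sum_net_laplacian: "(\<Sum>v\<in>V. net_laplacian E h v) = 0"
  using green[of "\<lambda>_. 1" h] by simp

lemma energy_nonneg: "(\<Sum>v\<in>V. h v * net_laplacian E h v) \<ge> 0"
  unfolding green by (auto intro!: sum_nonneg)

lemma net_laplacian_outside: "v \<notin> V \<Longrightarrow> net_laplacian E h v = 0"
  using E_subset by (auto simp: net_laplacian_def intro!: sum.neutral)

lemma sum_potential:
  assumes "potential E i j h" "i \<in> V" "j \<in> V"
  shows "(\<Sum>v\<in>V. g v * net_laplacian E h v) = g i - g j"
proof -
  have "(\<Sum>v\<in>V. g v * net_laplacian E h v) = (\<Sum>v\<in>V. g v * (of_bool (v = i) - of_bool (v = j)))"
    using assms(1) unfolding potential_def by (intro sum.cong) auto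
  then show ?thesis
    using assms(2,3) finite_V by (simp add: right_diff_distrib sum_subtractf sum_mult_of_bool)
qed

text \<open>
  Pairing the Laplacian of one potential with the other gives the voltage drop of either of them,
  according to the side from which the symmetric form is read.
\<close>

lemma potential_drop_unique:
  assumes "potential E i j h" "potential E i j h'" "i \<in> V" "j \<in> V"
  shows "h i - h j = h' i - h' j"
  using green_commute[of h h'] sum_potential[OF assms(1,3,4), of h']
    sum_potential[OF assms(2,3,4), of h] by simp

lemma resistance_eq:
  assumes "potential E i j h" "i \<in> V" "j \<in> V"
  shows "resistance E i j = h i - h j"
  unfolding resistance_def Let_def
  using potential_drop_unique[OF someI[of "potential E i j", OF assms(1)] assms] .

lemma resistance_self: "i \<in> V \<Longrightarrow> resistance E i i = 0"
  using resistance_eq[of i i "\<lambda>_. 0"] by (simp add: potential_def net_laplacian_def)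

end

text \<open>
  Solvability for every pair of nodes is the only form in which connectedness enters the
  resistance arguments, and it is inherited by the two sides of a bridge without any discussion of
  paths.
\<close>

locale network = simple_graph +
  assumes potential_exists: "i \<in> V \<Longrightarrow> j \<in> V \<Longrightarrow> \<exists>h. potential E i j h"
begin

lemma resistance_commute:
  assumes "i \<in> V" "j \<in> V"
  shows "resistance E i j = resistance E j i"
proof -
  obtain h where h: "potential E i j h"
    using potential_exists assms by blast
  have "net_laplacian E (\<lambda>x. - h x) v = - net_laplacian E h v" for v
    unfolding net_laplacian_def sum_negf[symmetric] by simp
  then have "potential E j i (\<lambda>x. - h x)"
    using h by (simp add: potential_def)
  from resistance_eq[OF this assms(2,1)] resistance_eq[OF h assms] show ?thesis
    by simp
qed

text \<open>
  The dual (Dirichlet) form of the variational principle for the effective resistance: if \<open>h\<close> is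
  the potential, the energy of \<open>f - h\<close> is nonnegative, and expanding it gives the claim.
\<close>

lemma resistance_ge_test:
  assumes "i \<in> V" "j \<in> V"
  shows "resistance E i j \<ge> 2 * (f i - f j) - (\<Sum>v\<in>V. f v * net_laplacian E f v)"
proof -
  obtain h where h: "potential E i j h"
    using potential_exists assms by blast
  let ?d = "\<lambda>g h. \<Sum>v\<in>V. g v * net_laplacian E h v"
  have lin: "net_laplacian E (\<lambda>x. f x - h x) v = net_laplacian E f v - net_laplacian E h v" for v
    unfolding net_laplacian_def sum_subtractf[symmetric] by (simp add: algebra_simps)
  have "0 \<le> ?d (\<lambda>x. f x - h x) (\<lambda>x. f x - h x)"
    by (rule energy_nonneg)
  also have "\<dots> = ?d f f - ?d h f - ?d f h + ?d h h"
    unfolding lin by (simp add: algebra_simps sum.distrib sum_subtractf)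
  also have "?d h f = ?d f h" by (rule green_commute)
  finally show ?thesis
    using sum_potential[OF h assms, of f] sum_potential[OF h assms, of h] resistance_eq[OF h assms]
    by simp
qed

text \<open>
  The test function is \<open>t\<close> at \<open>i\<close>, \<open>- t\<close> at \<open>j\<close> and \<open>0\<close> elsewhere. An edge between \<open>i\<close> and \<open>j\<close>
  has drop \<open>2 * t\<close> and thus energy \<open>4 * t\<^sup>2\<close>, of which the two degrees account for half.
\<close>

lemma resistance_ge_degrees:
  assumes "i \<in> V" "j \<in> V" "i \<noteq> j"
  defines "s \<equiv> card (E `` {i}) + card (E `` {j}) + 2 * of_bool ((i, j) \<in> E)"
  shows "resistance E i j \<ge> 4 * t - t\<^sup>2 * real s"
proof -
  define f :: "'a \<Rightarrow> real" where "f = (\<lambda>x. t * (of_bool (x = i) - of_bool (x = j)))"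
  have delta: "(\<Sum>w\<in>E `` {v}. of_bool (w = x)) = (of_bool ((v, x) \<in> E) :: real)" for v x
    using finite_nbrs[of v] by (simp add: of_bool_def sum.delta')
  have lap: "net_laplacian E f v
      = real (card (E `` {v})) * f v - t * (of_bool ((v, i) \<in> E) - of_bool ((v, j) \<in> E))" for v
    unfolding net_laplacian_def sum_subtractf
    by (simp add: f_def sum_distrib_left[symmetric] sum_subtractf delta)
  have ij: "(j, i) \<in> E \<longleftrightarrow> (i, j) \<in> E" using E_sym by blast
  have "(\<Sum>v\<in>V. f v * net_laplacian E f v)
      = t * (\<Sum>v\<in>V. of_bool (v = i) * net_laplacian E f v) - t * (\<Sum>v\<in>V. of_bool (v = j) * net_laplacian E f v)"
    unfolding sum_distrib_left sum_subtractf[symmetric]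
    by (rule sum.cong) (auto simp: f_def algebra_simps)
  also have "\<dots> = t * (net_laplacian E f i - net_laplacian E f j)"
    using assms(1,2) finite_V
    by (simp add: mult.commute[of "of_bool _"] sum_mult_of_bool right_diff_distrib)
  also have "\<dots> = t\<^sup>2 * real s"
    using assms(3) E_irrefl unfolding lap
    by (simp add: f_def s_def ij power2_eq_square algebra_simps)
  finally show ?thesis
    using resistance_ge_test[OF assms(1,2), of f] assms(3) by (simp add: f_def)
qed

text \<open>
  A node is not its own neighbour, so its degree is at most \<open>card V - 1\<close>. Adding the adjacency with
  one further node gives the form that occurs in \<open>resistance_ge_degrees\<close>.
\<close>

lemma degree_add_adjacency_le:
  assumes "i \<in> V"
  shows "card (E `` {i}) + of_bool ((i, j) \<in> E) \<le> card V"
    and "card (E `` {i}) + of_bool ((i, j) \<in> E) = card V \<Longrightarrow> E `` {i} = V - {i}"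
proof -
  have sub: "E `` {i} \<subseteq> V - {i}"
    using E_subset E_irrefl by auto
  have cV: "card V = card (V - {i}) + 1"
    using assms finite_V by (metis Suc_eq_plus1 card_Suc_Diff1)
  have le: "card (E `` {i}) \<le> card (V - {i})"
    using sub finite_V by (simp add: card_mono)
  then show "card (E `` {i}) + of_bool ((i, j) \<in> E) \<le> card V"
    using cV by simp
  assume "card (E `` {i}) + of_bool ((i, j) \<in> E) = card V"
  then have "card (E `` {i}) \<ge> card (V - {i})"
    using cV by (cases "(i, j) \<in> E") auto
  then show "E `` {i} = V - {i}"
    using card_seteq[OF _ sub] finite_V by blast
qed

text \<open>
  A network on \<open>n\<close> nodes conducts at best as well as the complete graph, where every resistance is
  \<open>2 / n\<close>. The test function with \<open>t = 1 / n\<close>, which is the optimal one on the complete graph,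
  shows this and also detects any missing edge at \<open>i\<close> or \<open>j\<close>.
\<close>

lemma resistance_ge:
  assumes "i \<in> V" "j \<in> V" "i \<noteq> j"
  shows "resistance E i j \<ge> 2 / card V"
    and "resistance E i j = 2 / card V \<Longrightarrow> E `` {i} = V - {i} \<and> E `` {j} = V - {j}"
proof -
  let ?n = "card V"
  define s where "s = card (E `` {i}) + card (E `` {j}) + 2 * of_bool ((i, j) \<in> E)"
  have n: "?n > 0" using assms finite_V by (auto simp: card_gt_0_iff)
  have ij: "(j, i) \<in> E \<longleftrightarrow> (i, j) \<in> E" using E_sym by blast
  note di = degree_add_adjacency_le[OF assms(1), of j]
  note dj = degree_add_adjacency_le[OF assms(2), of i, unfolded ij]
  have s: "s = (card (E `` {i}) + of_bool ((i, j) \<in> E)) + (card (E `` {j}) + of_bool ((i, j) \<in> E))"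
    by (simp add: s_def)
  have s_le: "s \<le> 2 * ?n"
    unfolding s using di(1) dj(1) by linarith
  have R: "resistance E i j \<ge> 4 / ?n - real s / (real ?n)\<^sup>2"
    using resistance_ge_degrees[OF assms, of "1 / ?n", folded s_def] by (simp add: power_divide)
  have "2 / real ?n = 4 / ?n - real (2 * ?n) / (real ?n)\<^sup>2"
    using n by (simp add: power2_eq_square field_simps)
  also have "\<dots> \<le> 4 / ?n - real s / (real ?n)\<^sup>2"
    using s_le by (intro diff_left_mono divide_right_mono) auto
  finally have base: "2 / ?n \<le> 4 / ?n - real s / (real ?n)\<^sup>2" .
  with R show "resistance E i j \<ge> 2 / card V" by linarith
  assume "resistance E i j = 2 / card V"
  with base R have "2 / ?n = 4 / ?n - real s / (real ?n)\<^sup>2" by linarith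
  then have "s = 2 * ?n"
    using n by (simp add: power2_eq_square field_simps)
  then have "card (E `` {i}) + of_bool ((i, j) \<in> E) = ?n" "card (E `` {j}) + of_bool ((i, j) \<in> E) = ?n"
    using di(1) dj(1) unfolding s by linarith+
  then show "E `` {i} = V - {i} \<and> E `` {j} = V - {j}"
    using di(2) dj(2) by blast
qed

lemma resistance_nonneg:
  assumes "i \<in> V" "j \<in> V"
  shows "resistance E i j \<ge> 0"
  using resistance_ge(1)[OF assms] resistance_self assms
  by (cases "i = j") (auto intro: order_trans[rotated])

lemma resistance_eq_0_iff:
  assumes "i \<in> V" "j \<in> V"
  shows "resistance E i j = 0 \<longleftrightarrow> i = j"
proof -
  have "card V > 0" using assms finite_V by (auto simp: card_gt_0_iff)
  then show ?thesis
    using resistance_ge(1)[OF assms] resistance_self assms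
    by (cases "i = j") force+
qed

text \<open>
  By symmetry the potential is supported on \<open>i\<close> and \<open>j\<close>.
\<close>

lemma complete_resistance:
  assumes "E = {(x, y). x \<in> V \<and> y \<in> V \<and> x \<noteq> y}" "i \<in> V" "j \<in> V" "i \<noteq> j"
  shows "resistance E i j = 2 / card V"
proof -
  let ?n = "real (card V)"
  define h :: "'a \<Rightarrow> real" where "h = (\<lambda>x. (of_bool (x = i) - of_bool (x = j)) / ?n)"
  have n: "?n > 0" using assms finite_V by (auto simp: card_gt_0_iff)
  have sum0: "(\<Sum>w\<in>V. h w) = 0"
    using assms(2-) finite_V
    by (simp add: h_def sum_divide_distrib[symmetric] sum_subtractf of_bool_def sum.delta')
  have "net_laplacian E h v = of_bool (v = i) - of_bool (v = j)" if "v \<in> V" for v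
  proof -
    have "E `` {v} = V - {v}" using assms(1) that by auto
    then have "net_laplacian E h v = (\<Sum>w\<in>V - {v}. h v - h w)" by (simp add: net_laplacian_def)
    also have "\<dots> = (\<Sum>w\<in>V. h v - h w)"
      using that finite_V by (simp add: sum.remove[of V v])
    also have "\<dots> = ?n * h v" using sum0 by (simp add: sum_subtractf)
    finally show ?thesis using n by (simp add: h_def)
  qed
  then have "potential E i j h"
    unfolding potential_def using net_laplacian_outside assms(2,3) by (metis diff_self of_bool_eq(1))
  from resistance_eq[OF this assms(2,3)] show ?thesis
    using assms(4) by (simp add: h_def)
qed

text \<open>
  The base case of the induction over bridges: termwise application of the bound \<open>2 / n\<close>. If all
  terms are tight, every node is adjacent to all others.
\<close>

lemma farness_ge:
  assumes "v \<in> V"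
  shows "farness V E v \<ge> 2 - 2 / card V"
    and "farness V E v = 2 - 2 / card V \<Longrightarrow> E = {(x, y). x \<in> V \<and> y \<in> V \<and> x \<noteq> y}"
proof -
  let ?n = "real (card V)"
  have n: "?n > 0" using assms finite_V by (auto simp: card_gt_0_iff)
  have "real (card (V - {v})) = ?n - 1" using assms n by simp
  then have const: "(\<Sum>i\<in>V - {v}. 2 / ?n) = 2 - 2 / ?n"
    using n by (simp add: field_simps)
  have far: "farness V E v = (\<Sum>i\<in>V - {v}. resistance E i v)"
    unfolding farness_def using assms finite_V resistance_self by (simp add: sum.remove[of V v])
  have le: "2 / ?n \<le> resistance E i v" if "i \<in> V - {v}" for i
    using resistance_ge(1) assms that by blast
  show "farness V E v \<ge> 2 - 2 / card V"
    unfolding far const[symmetric] using le by (rule sum_mono)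
  assume eq: "farness V E v = 2 - 2 / card V"
  have each: "resistance E i v = 2 / ?n" if "i \<in> V - {v}" for i
  proof -
    have "(\<Sum>i\<in>V - {v}. resistance E i v - 2 / ?n) = 0"
      unfolding sum_subtractf const using eq far by simp
    then show ?thesis
      using sum_nonneg_eq_0_iff[of "V - {v}" "\<lambda>i. resistance E i v - 2 / ?n"] le finite_V that by auto
  qed
  have "E `` {i} = V - {i}" if i: "i \<in> V" for i
  proof (cases "V = {v}")
    case True
    then show ?thesis using i E_subset E_irrefl by blast
  next
    case False
    then obtain w where w: "w \<in> V - {v}" using assms by auto
    show ?thesis
      using i resistance_ge(2)[of i v] resistance_ge(2)[of w v] each w assms by (cases "i = v") auto
  qed
  then show "E = {(x, y). x \<in> V \<and> y \<in> V \<and> x \<noteq> y}"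
    using E_subset by auto
qed

lemma kirchhoff_eq_sum_farness: "kirchhoff V E = (\<Sum>v\<in>V. farness V E v) / 2"
  unfolding kirchhoff_def farness_def by (subst sum.swap) simp

lemma kirchhoff_ge:
  assumes "V \<noteq> {}"
  shows "kirchhoff V E \<ge> real (card V) - 1"
    and "kirchhoff V E = real (card V) - 1 \<Longrightarrow> E = {(x, y). x \<in> V \<and> y \<in> V \<and> x \<noteq> y}"
proof -
  let ?n = "real (card V)"
  have n: "?n > 0" using assms finite_V by (auto simp: card_gt_0_iff)
  have const: "(\<Sum>v\<in>V. 2 - 2 / ?n) / 2 = ?n - 1"
    using n by (simp add: field_simps)
  show "kirchhoff V E \<ge> real (card V) - 1"
    unfolding kirchhoff_eq_sum_farness const[symmetric]
    by (intro divide_right_mono sum_mono farness_ge) auto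
  assume eq: "kirchhoff V E = real (card V) - 1"
  have "(\<Sum>v\<in>V. farness V E v - (2 - 2 / ?n)) = 0"
    unfolding sum_subtractf[of "farness V E"] using eq const unfolding kirchhoff_eq_sum_farness
    by linarith
  then have "\<forall>v\<in>V. farness V E v - (2 - 2 / ?n) = 0"
    using sum_nonneg_eq_0_iff[of V "\<lambda>v. farness V E v - (2 - 2 / ?n)"] farness_ge(1) finite_V by auto
  then show "E = {(x, y). x \<in> V \<and> y \<in> V \<and> x \<noteq> y}"
    using assms farness_ge(2) by auto
qed

end

section \<open>Two graphs joined by a bridge\<close>

text \<open>
  The two sides are kept as graphs of their own, so that an induction hypothesis applies to them.
  The situation is symmetric, which the lemma \<open>flip\<close> expresses; statements about the right side
  follow from those about the left one.
\<close>

locale bridge_join = A: simple_graph A EA + B: simple_graph B EB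
  for A :: "'a set" and EA and B and EB +
  fixes a b :: 'a
  assumes a_in: "a \<in> A" and b_in: "b \<in> B" and disjoint: "A \<inter> B = {}"
begin

abbreviation V where "V \<equiv> A \<union> B"
abbreviation E where "E \<equiv> EA \<union> EB \<union> {(a, b), (b, a)}"

lemma a_notin: "a \<notin> B" and b_notin: "b \<notin> A"
  using a_in b_in disjoint by auto

lemma flip: "bridge_join B EB A EA b a"
  by unfold_locales (use a_in b_in disjoint in auto)

lemma E_flip: "EB \<union> EA \<union> {(b, a), (a, b)} = E" by auto

lemma laplacian_left:
  assumes "v \<in> A"
  shows "net_laplacian E h v = net_laplacian EA h v + of_bool (v = a) * (h a - h b)"
proof (cases "v = a")
  case True
  have "E `` {a} = insert b (EA `` {a})" "b \<notin> EA `` {a}"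
    using B.E_subset A.E_subset a_notin b_notin by auto
  then show ?thesis
    using True A.finite_nbrs by (simp add: net_laplacian_def)
next
  case False
  then have "E `` {v} = EA `` {v}"
    using assms B.E_subset disjoint b_notin by auto
  then show ?thesis using False by (simp add: net_laplacian_def)
qed

text \<open>
  The current entering the left side has to leave it through the bridge.
\<close>

lemma sum_laplacian_left: "(\<Sum>v\<in>A. net_laplacian E h v) = h a - h b"
proof -
  have "(\<Sum>v\<in>A. net_laplacian E h v)
      = (\<Sum>v\<in>A. net_laplacian EA h v) + (\<Sum>v\<in>A. (h a - h b) * of_bool (v = a))"
    unfolding sum.distrib[symmetric]
    by (rule sum.cong[OF refl]) (simp only: laplacian_left mult.commute)
  then show ?thesis
    using A.sum_net_laplacian A.finite_V a_in sum_mult_of_bool[of A a "\<lambda>_. h a - h b"] by simp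
qed

text \<open>
  Between two nodes on the same side no current crosses the bridge, so both ends of it have the
  same voltage and the other side may be ignored.
\<close>

lemma potential_left_left:
  assumes "potential E i j h" "i \<in> A" "j \<in> A"
  shows "potential EA i j h"
proof -
  have "(\<Sum>v\<in>B. net_laplacian E h v) = 0"
    using assms disjoint by (intro sum.neutral) (auto simp: potential_def)
  then have "h b = h a"
    using bridge_join.sum_laplacian_left[OF flip, of h] unfolding E_flip by simp
  then have "net_laplacian EA h v = of_bool (v = i) - of_bool (v = j)" if "v \<in> A" for v
    using laplacian_left[OF that, of h] assms(1) by (simp add: potential_def)
  then show ?thesis
    unfolding potential_def using A.net_laplacian_outside assms(2,3)
    by (metis diff_self of_bool_eq(1))
qed

text \<open>
  Between nodes on different sides the whole unit current crosses the bridge. On the left side it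
  therefore flows from \<open>i\<close> to \<open>a\<close>.
\<close>

lemma potential_left_right:
  assumes "potential E i j h" "i \<in> A" "j \<in> B"
  shows "potential EA i a h" and "h a - h b = 1"
proof -
  have eq: "net_laplacian E h v = of_bool (v = i)" if "v \<in> A" for v
    using that assms disjoint by (auto simp: potential_def)
  have "(\<Sum>v\<in>A. net_laplacian E h v) = (\<Sum>v\<in>A. 1 * of_bool (v = i))"
    by (rule sum.cong[OF refl]) (simp only: eq mult_1)
  then show drop: "h a - h b = 1"
    using sum_laplacian_left[of h] sum_mult_of_bool[of A i "\<lambda>_. 1"] assms(2) A.finite_V by simp
  have "net_laplacian EA h v = of_bool (v = i) - of_bool (v = a)" if "v \<in> A" for v
    using laplacian_left[OF that, of h] eq[OF that] drop by simp
  then show "potential EA i a h"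
    unfolding potential_def using A.net_laplacian_outside assms(2) a_in
    by (metis diff_self of_bool_eq(1))
qed

lemma bridges_left_subset: "bridges EA \<subseteq> Pow A"
  using A.E_subset by (auto simp: bridges_def)

text \<open>
  Collapsing the right side to \<open>a\<close> maps every walk of the joined graph to a walk on the left side.
  A detour through the bridge thus never helps to connect two nodes of one side.
\<close>

lemma reach_left:
  assumes "(x, y) \<in> (E - {(u, v), (v, u)})\<^sup>*" "u \<in> A" "v \<in> A"
  defines "p \<equiv> \<lambda>z. if z \<in> A then z else a"
  shows "(p x, p y) \<in> (EA - {(u, v), (v, u)})\<^sup>*"
  using assms(1)
proof induction
  case base
  then show ?case by simp
next
  case (step y z)
  have "p y = p z \<or> (p y, p z) \<in> EA - {(u, v), (v, u)}"
    using step(2) A.E_subset B.E_subset disjoint a_in b_notin by (auto simp: p_def)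
  then show ?case using step(3) by (auto intro: rtrancl_into_rtrancl)
qed

lemma bridge_left_iff:
  assumes "(u, v) \<in> EA"
  shows "(u, v) \<in> (E - {(u, v), (v, u)})\<^sup>* \<longleftrightarrow> (u, v) \<in> (EA - {(u, v), (v, u)})\<^sup>*"
proof
  assume "(u, v) \<in> (E - {(u, v), (v, u)})\<^sup>*"
  from reach_left[OF this] show "(u, v) \<in> (EA - {(u, v), (v, u)})\<^sup>*"
    using assms A.E_subset by auto
next
  have "EA - {(u, v), (v, u)} \<subseteq> E - {(u, v), (v, u)}" by blast
  then show "(u, v) \<in> (EA - {(u, v), (v, u)})\<^sup>* \<Longrightarrow> (u, v) \<in> (E - {(u, v), (v, u)})\<^sup>*"
    using rtrancl_mono by blast
qed

lemma bridge_right_iff: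
  assumes "(u, v) \<in> EB"
  shows "(u, v) \<in> (E - {(u, v), (v, u)})\<^sup>* \<longleftrightarrow> (u, v) \<in> (EB - {(u, v), (v, u)})\<^sup>*"
  using bridge_join.bridge_left_iff[OF flip assms] unfolding E_flip .

lemma join_edge_not_reach: "(a, b) \<notin> (E - {(a, b), (b, a)})\<^sup>*"
proof
  assume *: "(a, b) \<in> (E - {(a, b), (b, a)})\<^sup>*"
  have "y \<in> A" if "(a, y) \<in> (E - {(a, b), (b, a)})\<^sup>*" for y
    using that
  proof induction
    case base
    then show ?case by (rule a_in)
  next
    case (step y z)
    then show ?case using A.E_subset B.E_subset disjoint by auto
  qed
  from this[OF *] show False using b_notin by simp
qed

lemma bridges_join: "bridges E = insert {a, b} (bridges EA \<union> bridges EB)"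
proof (intro equalityI subsetI)
  fix e assume "e \<in> bridges E"
  then obtain u v where e: "e = {u, v}" "(u, v) \<in> E" "(u, v) \<notin> (E - {(u, v), (v, u)})\<^sup>*"
    by (auto simp: bridges_def)
  then consider "(u, v) \<in> EA" | "(u, v) \<in> EB" | "e = {a, b}" by auto
  then show "e \<in> insert {a, b} (bridges EA \<union> bridges EB)"
  proof cases
    case 1
    then have "e \<in> bridges EA" using e bridge_left_iff unfolding bridges_def by blast
    then show ?thesis by simp
  next
    case 2
    then have "e \<in> bridges EB" using e bridge_right_iff unfolding bridges_def by blast
    then show ?thesis by simp
  qed simp
next
  fix e assume "e \<in> insert {a, b} (bridges EA \<union> bridges EB)"
  then consider "e \<in> bridges EA" | "e \<in> bridges EB" | "e = {a, b}" by auto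
  then show "e \<in> bridges E"
  proof cases
    case 1
    then obtain u v where "e = {u, v}" "(u, v) \<in> EA" "(u, v) \<notin> (EA - {(u, v), (v, u)})\<^sup>*"
      by (auto simp: bridges_def)
    then have "e = {u, v} \<and> (u, v) \<in> E \<and> (u, v) \<notin> (E - {(u, v), (v, u)})\<^sup>*"
      using bridge_left_iff by blast
    then show ?thesis unfolding bridges_def by blast
  next
    case 2
    then obtain u v where "e = {u, v}" "(u, v) \<in> EB" "(u, v) \<notin> (EB - {(u, v), (v, u)})\<^sup>*"
      by (auto simp: bridges_def)
    then have "e = {u, v} \<and> (u, v) \<in> E \<and> (u, v) \<notin> (E - {(u, v), (v, u)})\<^sup>*"
      using bridge_right_iff by blast
    then show ?thesis unfolding bridges_def by blast
  next
    case 3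
    then have "e = {a, b} \<and> (a, b) \<in> E \<and> (a, b) \<notin> (E - {(a, b), (b, a)})\<^sup>*"
      using join_edge_not_reach by blast
    then show ?thesis unfolding bridges_def by blast
  qed
qed

text \<open>
  The three parts of \<open>bridges_join\<close> are disjoint because they lie within \<open>A\<close>, within \<open>B\<close> and across.
\<close>

lemma card_bridges_join: "card (bridges E) = card (bridges EA) + card (bridges EB) + 1"
proof -
  have A: "bridges EA \<subseteq> Pow A" by (rule bridges_left_subset)
  have B: "bridges EB \<subseteq> Pow B" by (rule bridge_join.bridges_left_subset[OF flip])
  have fin: "finite (bridges EA)" "finite (bridges EB)"
    using A B A.finite_V B.finite_V by (auto intro: finite_subset)
  have "{} \<notin> bridges EA" by (auto simp: bridges_def)
  moreover have "e = {}" if "e \<in> bridges EA" "e \<in> bridges EB" for e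
  proof -
    have "e \<subseteq> A \<inter> B" using that A B by auto
    then show ?thesis using disjoint by simp
  qed
  ultimately have "bridges EA \<inter> bridges EB = {}"
    by auto
  moreover have "{a, b} \<notin> bridges EA \<union> bridges EB"
    using A B a_notin b_notin by blast
  ultimately show ?thesis
    unfolding bridges_join using fin by (simp add: card_Un_disjoint)
qed

lemma card_V: "card V = card A + card B"
  using A.finite_V B.finite_V disjoint by (simp add: card_Un_disjoint)

lemma network_left:
  assumes "network V E"
  shows "network A EA"
proof
  fix i j assume "i \<in> A" "j \<in> A"
  then show "\<exists>h. potential EA i j h"
    using network.potential_exists[OF assms, of i j] potential_left_left by blast
qed

lemma network_right:
  assumes "network V E"
  shows "network B EB"
  using bridge_join.network_left[OF flip] assms by (simp only: E_flip Un_commute[of B A])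

lemma resistance_left_left:
  assumes "network V E" "i \<in> A" "j \<in> A"
  shows "resistance E i j = resistance EA i j"
proof -
  interpret N: network V E by fact
  obtain h where h: "potential E i j h"
    using N.potential_exists assms(2,3) by blast
  show ?thesis
    using N.resistance_eq[OF h] A.resistance_eq[OF potential_left_left[OF h assms(2,3)]] assms by simp
qed

text \<open>
  Resistances in series.
\<close>

lemma resistance_left_right:
  assumes "network V E" "i \<in> A" "j \<in> B"
  shows "resistance E i j = resistance EA i a + 1 + resistance EB j b"
proof -
  interpret N: network V E by fact
  obtain h where h: "potential E i j h"
    using N.potential_exists assms(2,3) by blast
  have "net_laplacian E (\<lambda>x. - h x) v = - net_laplacian E h v" for v
    unfolding net_laplacian_def sum_negf[symmetric] by simp
  then have neg: "potential (EB \<union> EA \<union> {(b, a), (a, b)}) j i (\<lambda>x. - h x)"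
    using h unfolding E_flip by (simp add: potential_def)
  have "resistance EA i a = h i - h a"
    using A.resistance_eq potential_left_right(1)[OF h assms(2,3)] assms(2) a_in by blast
  moreover have "resistance EB j b = - h j - - h b"
    using B.resistance_eq[OF bridge_join.potential_left_right(1)[OF flip neg assms(3,2)] assms(3) b_in] .
  ultimately show ?thesis
    using N.resistance_eq[OF h] potential_left_right(2)[OF h assms(2,3)] assms(2,3) by simp
qed

lemma farness_left:
  assumes "network V E" "v \<in> A"
  shows "farness V E v
    = farness A EA v + card B * (resistance EA v a + 1) + farness B EB b"
proof -
  interpret N: network V E by fact
  have "farness V E v = (\<Sum>i\<in>A. resistance E i v) + (\<Sum>i\<in>B. resistance E i v)"
    unfolding farness_def using A.finite_V B.finite_V disjoint by (rule sum.union_disjoint)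
  also have "(\<Sum>i\<in>A. resistance E i v) = farness A EA v"
    unfolding farness_def using resistance_left_left assms by simp
  also have "(\<Sum>i\<in>B. resistance E i v) = (\<Sum>i\<in>B. (resistance EA v a + 1) + resistance EB i b)"
    using N.resistance_commute resistance_left_right[OF assms] assms(2)
    by (intro sum.cong) auto
  finally show ?thesis by (simp add: sum.distrib farness_def)
qed

lemma farness_right:
  assumes "network V E" "v \<in> B"
  shows "farness V E v
    = farness B EB v + card A * (resistance EB v b + 1) + farness A EA a"
  using bridge_join.farness_left[OF flip] assms by (simp only: E_flip Un_commute[of B A])

text \<open>
  Each of the \<open>card A * card B\<close> pairs that are separated by the bridge contributes \<open>1\<close> for the
  bridge itself and the resistances from its nodes to \<open>a\<close> and \<open>b\<close>.
\<close>

lemma kirchhoff_join: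
  assumes "network V E"
  shows "kirchhoff V E = kirchhoff A EA + kirchhoff B EB + card A * card B
    + card B * farness A EA a + card A * farness B EB b"
proof -
  interpret N: network V E by fact
  interpret NA: network A EA by (rule network_left) fact
  interpret NB: network B EB by (rule network_right) fact
  have sa: "(\<Sum>v\<in>A. resistance EA v a) = farness A EA a" by (simp add: farness_def)
  have sb: "(\<Sum>v\<in>B. resistance EB v b) = farness B EB b" by (simp add: farness_def)
  have "2 * kirchhoff V E = (\<Sum>v\<in>A. farness V E v) + (\<Sum>v\<in>B. farness V E v)"
    unfolding N.kirchhoff_eq_sum_farness using A.finite_V B.finite_V disjoint
    by (simp add: sum.union_disjoint)
  also have "(\<Sum>v\<in>A. farness V E v)
      = (\<Sum>v\<in>A. farness A EA v + card B * (resistance EA v a + 1) + farness B EB b)"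
    using farness_left[OF assms] by simp
  also have "\<dots> = 2 * kirchhoff A EA + card B * farness A EA a + card A * card B + card A * farness B EB b"
    unfolding NA.kirchhoff_eq_sum_farness sum.distrib sum_distrib_left[symmetric] sa
    by (simp add: algebra_simps)
  also have "(\<Sum>v\<in>B. farness V E v)
      = (\<Sum>v\<in>B. farness B EB v + card A * (resistance EB v b + 1) + farness A EA a)"
    using farness_right[OF assms] by simp
  also have "\<dots> = 2 * kirchhoff B EB + card A * farness B EB b + card A * card B + card B * farness A EA a"
    unfolding NB.kirchhoff_eq_sum_farness sum.distrib sum_distrib_left[symmetric] sb
    by (simp add: algebra_simps)
  finally show ?thesis by (simp add: algebra_simps)
qed

end

text \<open>
  One side consists of the nodes that \<open>a\<close> still reaches once the bridge is removed. An edge that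
  leaves this set must be the bridge.
\<close>

lemma (in simple_graph) split_at_bridge:
  assumes "(a, b) \<in> E" "(a, b) \<notin> (E - {(a, b), (b, a)})\<^sup>*"
  obtains A EA B EB where "bridge_join A EA B EB a b" "V = A \<union> B"
    "E = EA \<union> EB \<union> {(a, b), (b, a)}"
proof -
  define A where "A = {x \<in> V. (a, x) \<in> (E - {(a, b), (b, a)})\<^sup>*}"
  define B where "B = V - A"
  define EA where "EA = E \<inter> A \<times> A"
  define EB where "EB = E \<inter> B \<times> B"
  have ab: "a \<in> A" "b \<in> B" "b \<notin> A" "a \<notin> B"
    using assms E_subset by (auto simp: A_def B_def)
  have cross: "(x, y) = (a, b)" if "(x, y) \<in> E" "x \<in> A" "y \<notin> A" for x y
  proof (rule ccontr)
    assume "(x, y) \<noteq> (a, b)"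
    moreover have "(x, y) \<noteq> (b, a)" using that ab by auto
    ultimately have "(x, y) \<in> E - {(a, b), (b, a)}" using that by simp
    then have "(a, y) \<in> (E - {(a, b), (b, a)})\<^sup>*"
      using that(2) by (auto simp: A_def intro: rtrancl_into_rtrancl)
    then show False using that E_subset by (auto simp: A_def)
  qed
  have "E = EA \<union> EB \<union> {(a, b), (b, a)}"
  proof (intro equalityI subsetI)
    fix e assume e: "e \<in> E"
    obtain x y where xy: "e = (x, y)" by (cases e)
    show "e \<in> EA \<union> EB \<union> {(a, b), (b, a)}"
      using e cross[of x y] cross[of y x] E_sym[of x y] E_subset
      unfolding xy EA_def EB_def B_def by blast
  qed (use assms(1) E_sym EA_def EB_def in auto)
  moreover have "bridge_join A EA B EB a b"
    using ab finite_V E_irrefl E_sym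
    by unfold_locales (auto simp: A_def B_def EA_def EB_def)
  moreover have "V = A \<union> B" by (auto simp: A_def B_def)
  ultimately show ?thesis using that by blast
qed

section \<open>Lower bounds by induction over bridges\<close>

text \<open>
  The farness of the centre and the Kirchhoff index of a clique on \<open>n - k\<close> nodes with \<open>k\<close> pendant
  nodes attached to one of its nodes, as \<open>star_of_clique_values\<close> confirms.
\<close>

definition farness_bound :: "real \<Rightarrow> real \<Rightarrow> real" where
  "farness_bound n k = k + 2 - 2 / (n - k)"

definition kirchhoff_bound :: "real \<Rightarrow> real \<Rightarrow> real" where
  "kirchhoff_bound n k = n + 1 + k * n - 2 * n / (n - k)"

lemma farness_bound_attach: "farness_bound (n + 1) (k + 1) = farness_bound n k + 1"
  by (simp add: farness_bound_def)

lemma kirchhoff_bound_attach: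
  "kirchhoff_bound (n + 1) (k + 1) = kirchhoff_bound n k + n + farness_bound n k"
  by (simp add: farness_bound_def kirchhoff_bound_def add_divide_distrib algebra_simps)

text \<open>
  The two sides are \<open>(p + q) / (p * q)\<close> and \<open>(p + q) / (p + q - 1)\<close>, and \<open>(p - 1) * (q - 1) \<ge> 0\<close>
  compares the denominators. This is the inequality on which the induction
  step rests: the two sides of a bridge have clique sizes \<open>p\<close>, \<open>q\<close>, and the joined graph has the
  clique size \<open>p + q - 1\<close>.
\<close>

lemma inverse_add_le:
  fixes p q :: real
  assumes "p \<ge> 1" "q \<ge> 1"
  shows "1 / p + 1 / q \<le> 1 + 1 / (p + q - 1)"
proof -
  have "0 \<le> (p - 1) * (q - 1)" using assms by simp
  then have le: "p + q - 1 \<le> p * q" by (simp add: algebra_simps)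
  have "1 / p + 1 / q = (p + q) / (p * q)" using assms by (simp add: field_simps)
  also have "\<dots> \<le> (p + q) / (p + q - 1)" using le assms by (intro divide_left_mono) auto
  also have "\<dots> = 1 + 1 / (p + q - 1)" using assms by (simp add: field_simps)
  finally show ?thesis .
qed

lemma farness_bound_join:
  assumes "n1 - k1 \<ge> 1" "n2 - k2 \<ge> 1"
  shows "farness_bound n1 k1 + 1 + farness_bound n2 k2 \<ge> farness_bound (n1 + n2) (k1 + k2 + 1)"
proof -
  have e: "n1 + n2 - (k1 + k2 + 1) = (n1 - k1) + (n2 - k2) - 1" by simp
  show ?thesis
    using inverse_add_le[OF assms] unfolding farness_bound_def e by linarith
qed

lemma kirchhoff_bound_join:
  assumes "n1 - k1 \<ge> 1" "n2 - k2 \<ge> 1" "n1 + n2 \<ge> 0"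
  shows "kirchhoff_bound n1 k1 + kirchhoff_bound n2 k2 + (n1 + n2 - 1)
    + n2 * farness_bound n1 k1 + n1 * farness_bound n2 k2 \<ge> kirchhoff_bound (n1 + n2) (k1 + k2 + 1)"
proof -
  define n where "n = n1 + n2"
  have e: "n1 + n2 - (k1 + k2 + 1) = (n1 - k1) + (n2 - k2) - 1" by simp
  have "n * (1 / (n1 - k1) + 1 / (n2 - k2)) \<le> n * (1 + 1 / (n1 + n2 - (k1 + k2 + 1)))"
    unfolding e n_def using inverse_add_le[OF assms(1,2)] assms(3) by (rule mult_left_mono)
  then have "2 * (n * (1 / (n1 - k1) + 1 / (n2 - k2)))
      \<le> 2 * (n * (1 + 1 / (n1 + n2 - (k1 + k2 + 1))))"
    by linarith
  then have "2 * n / (n1 - k1) + 2 * n / (n2 - k2) \<le> 2 * n + 2 * n / (n1 + n2 - (k1 + k2 + 1))"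
    by (simp only: distrib_left mult.assoc times_divide_eq_right mult_1_right)
  moreover have "kirchhoff_bound n1 k1 + n2 * farness_bound n1 k1
      = n + 1 + k1 * n + n2 - 2 * n / (n1 - k1)"
    by (simp add: kirchhoff_bound_def farness_bound_def n_def diff_divide_distrib add_divide_distrib algebra_simps)
  moreover have "kirchhoff_bound n2 k2 + n1 * farness_bound n2 k2
      = n + 1 + k2 * n + n1 - 2 * n / (n2 - k2)"
    by (simp add: kirchhoff_bound_def farness_bound_def n_def diff_divide_distrib add_divide_distrib algebra_simps)
  ultimately show ?thesis
    unfolding kirchhoff_bound_def n_def by (simp add: algebra_simps)
qed

text \<open>
  The number of pairs separated by a bridge is smallest when one side is a single node.
\<close>

lemma add_pred_le_mult:
  fixes p q :: nat
  assumes "p > 0" "q > 0"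
  shows "real p + real q - 1 \<le> real p * real q"
    and "real p * real q = real p + real q - 1 \<Longrightarrow> p = 1 \<or> q = 1"
proof -
  have "(real p - 1) * (real q - 1) \<ge> 0" using assms by simp
  then show "real p + real q - 1 \<le> real p * real q" by (simp add: algebra_simps)
  assume "real p * real q = real p + real q - 1"
  then have "(real p - 1) * (real q - 1) = 0" by (simp add: algebra_simps)
  then show "p = 1 \<or> q = 1" by simp
qed

lemma (in simple_graph) bridgeE:
  assumes "bridges E \<noteq> {}"
  obtains a A EA b B EB where "bridge_join A EA B EB a b" "V = A \<union> B"
    "E = EA \<union> EB \<union> {(a, b), (b, a)}"
proof -
  obtain a b where "(a, b) \<in> E" "(a, b) \<notin> (E - {(a, b), (b, a)})\<^sup>*"
    using assms by (auto simp: bridges_def)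
  from split_at_bridge[OF this] that show ?thesis by metis
qed

lemma (in simple_graph) bridgeE_side:
  assumes "bridges E \<noteq> {}" "v \<in> V"
  obtains a A EA b B EB where "bridge_join A EA B EB a b" "V = A \<union> B"
    "E = EA \<union> EB \<union> {(a, b), (b, a)}" "v \<in> A"
proof -
  obtain a A EA b B EB where j: "bridge_join A EA B EB a b" "V = A \<union> B"
    "E = EA \<union> EB \<union> {(a, b), (b, a)}"
    using bridgeE[OF assms(1)] .
  show ?thesis
  proof (cases "v \<in> A")
    case True
    then show ?thesis using that j by blast
  next
    case False
    have "bridge_join B EB A EA b a" using j(1) by (rule bridge_join.flip)
    moreover have "V = B \<union> A" "E = EB \<union> EA \<union> {(b, a), (a, b)}" using j(2,3) by auto
    ultimately show ?thesis using that False assms(2) by blast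
  qed
qed

text \<open>
  How the extremal graph grows in the equality case: the bridge carries a single node, and it starts
  at the centre of the extremal graph on the other side.
\<close>

lemma (in bridge_join) star_of_clique_attach:
  assumes "star_of_clique A EA a P" "B = {b}"
  shows "star_of_clique V E a (insert b P)"
proof -
  have "EB = {}" using B.E_subset B.E_irrefl assms(2) by auto
  moreover have "A \<union> B - insert b P = A - P" using assms(2) b_notin by auto
  ultimately show ?thesis
    using assms b_notin unfolding star_of_clique_def by auto
qed

lemma (in bridge_join) trivial_side: "card B = 1 \<Longrightarrow> B = {b}"
  using b_in by (auto simp: card_1_singleton_iff)

lemma (in simple_graph) bridges_singleton_graph:
  assumes "card V = 1" shows "bridges E = {}"
proof -
  obtain x where "V = {x}" using assms by (auto simp: card_1_singleton_iff)
  then have "E = {}" using E_subset E_irrefl by blast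
  then show ?thesis by (auto simp: bridges_def)
qed

lemma star_of_clique_complete:
  "v \<in> V \<Longrightarrow> E = {(x, y). x \<in> V \<and> y \<in> V \<and> x \<noteq> y} \<Longrightarrow> star_of_clique V E v {}"
  by (auto simp: star_of_clique_def)

text \<open>
  Each bridge cuts off at least one further node. This keeps the clique size \<open>n - k\<close> positive.
\<close>

lemma card_bridges_less:
  assumes "simple_graph V E" "V \<noteq> {}"
  shows "card (bridges E) < card V"
  using assms
proof (induction "card V" arbitrary: V E rule: less_induct)
  case less
  interpret simple_graph V E by fact
  show ?case
  proof (cases "bridges E = {}")
    case True
    then show ?thesis using less.prems(2) finite_V by (simp add: card_gt_0_iff)
  next
    case False
    from bridgeE[OF this] obtain a A EA b B EB where j: "bridge_join A EA B EB a b"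
      and V: "V = A \<union> B" and E: "E = EA \<union> EB \<union> {(a, b), (b, a)}" .
    interpret J: bridge_join A EA B EB a b by fact
    have "card A > 0" "card B > 0"
      using J.a_in J.b_in J.A.finite_V J.B.finite_V by (auto simp: card_gt_0_iff)
    then have "card A < card V" "card B < card V"
      using J.card_V V by auto
    then have "card (bridges EA) < card A" "card (bridges EB) < card B"
      using less.hyps[of A EA] less.hyps[of B EB] J.A.simple_graph_axioms J.B.simple_graph_axioms
        J.a_in J.b_in by auto
    then show ?thesis
      using J.card_bridges_join J.card_V unfolding V E by linarith
  qed
qed

lemma (in bridge_join) card_sides:
  "card A > 0" "card B > 0" "real (card A) - real (card (bridges EA)) \<ge> 1"
  "real (card B) - real (card (bridges EB)) \<ge> 1"
  "card A < card V" "card B < card V"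
proof -
  show pos: "card A > 0" "card B > 0"
    using a_in b_in A.finite_V B.finite_V by (auto simp: card_gt_0_iff)
  then show "card A < card V" "card B < card V" using card_V by auto
  have "card (bridges EA) < card A" "card (bridges EB) < card B"
    using card_bridges_less A.simple_graph_axioms B.simple_graph_axioms a_in b_in by blast+
  then show "real (card A) - real (card (bridges EA)) \<ge> 1"
    "real (card B) - real (card (bridges EB)) \<ge> 1" by linarith+
qed

text \<open>
  Choose \<open>A\<close> as the side of the bridge that contains \<open>v\<close>. The crossing contributes
  \<open>card B * (resistance EA v a + 1)\<close>, which is at least \<open>1\<close>, with equality only if \<open>B\<close> is a single
  node and \<open>v = a\<close>. Then \<open>B\<close> is a pendant node at \<open>v\<close>, and the equality case for \<open>A\<close> gives the
  rest of the structure.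
\<close>

lemma farness_lower_bound:
  assumes "network V E" "v \<in> V"
  shows "farness V E v \<ge> farness_bound (card V) (card (bridges E)) \<and>
    (farness V E v = farness_bound (card V) (card (bridges E)) \<longrightarrow>
      (\<exists>P. star_of_clique V E v P \<and> card P = card (bridges E)))"
  using assms
proof (induction "card V" arbitrary: V E v rule: less_induct)
  case less
  interpret network V E by fact
  show ?case
  proof (cases "bridges E = {}")
    case True
    then show ?thesis
      using farness_ge[OF less.prems(2)] star_of_clique_complete[OF less.prems(2)]
      by (auto simp: farness_bound_def)
  next
    case False
    from bridgeE_side[OF this less.prems(2)] obtain a A EA b B EB where
      j: "bridge_join A EA B EB a b" and V: "V = A \<union> B"
      and E: "E = EA \<union> EB \<union> {(a, b), (b, a)}" and v: "v \<in> A" .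
    interpret J: bridge_join A EA B EB a b by fact
    have net: "network J.V J.E" using less.prems(1) unfolding V E .
    interpret NA: network A EA by (rule J.network_left) fact
    interpret NB: network B EB by (rule J.network_right) fact
    let ?fA = "farness_bound (card A) (card (bridges EA))"
    let ?fB = "farness_bound (card B) (card (bridges EB))"
    have IHA: "farness A EA v \<ge> ?fA"
      "farness A EA v = ?fA \<Longrightarrow> \<exists>P. star_of_clique A EA v P \<and> card P = card (bridges EA)"
      using less.hyps[of A EA v] J.card_sides(5) V NA.network_axioms v by auto
    have IHB: "farness B EB b \<ge> ?fB"
      using less.hyps[of B EB b] J.card_sides(6) V NB.network_axioms J.b_in by auto
    have far: "farness V E v
        = farness A EA v + card B * (resistance EA v a + 1) + farness B EB b"
      using J.farness_left[OF net v] unfolding V E .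
    have bound: "farness_bound (card V) (card (bridges E)) \<le> ?fA + 1 + ?fB"
      using farness_bound_join[OF J.card_sides(3,4)]
      unfolding V E J.card_V J.card_bridges_join of_nat_add by simp
    have R: "resistance EA v a \<ge> 0" using NA.resistance_nonneg v J.a_in .
    have prod: "card B * (resistance EA v a + 1) = card B + card B * resistance EA v a"
      by (simp add: algebra_simps)
    have cB: "1 \<le> real (card B)" using J.card_sides(2) by linarith
    have BR: "0 \<le> card B * resistance EA v a" using R by simp
    show ?thesis
    proof (intro conjI impI)
      show "farness V E v \<ge> farness_bound (card V) (card (bridges E))"
        using bound IHA(1) IHB cB BR unfolding far prod by linarith
      assume "farness V E v = farness_bound (card V) (card (bridges E))"
      then have "real (card B) = 1" "card B * resistance EA v a = 0" "farness A EA v = ?fA"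
        using bound IHA(1) IHB cB BR unfolding far prod by linarith+
      then have c1: "card B = 1" and "v = a" and A: "farness A EA v = ?fA"
        using NA.resistance_eq_0_iff[OF v J.a_in] by auto
      from IHA(2)[OF A] obtain P where P: "star_of_clique A EA a P" "card P = card (bridges EA)"
        using \<open>v = a\<close> by auto
      have "star_of_clique V E v (insert b P)"
        using J.star_of_clique_attach[OF P(1) J.trivial_side[OF c1]] unfolding \<open>v = a\<close> V E .
      moreover have "card (insert b P) = card (bridges E)"
      proof -
        have "P \<subseteq> A" using P(1) by (simp add: star_of_clique_def)
        then have "b \<notin> P" "finite P" using J.b_notin J.A.finite_V by (auto intro: finite_subset)
        then show ?thesis
          using P(2) J.card_bridges_join J.B.bridges_singleton_graph[OF c1] unfolding E by simp
      qed
      ultimately show "\<exists>P. star_of_clique V E v P \<and> card P = card (bridges E)" by blast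
    qed
  qed
qed

text \<open>
  In the equality case one side of the bridge is a single pendant node and the farness of the other
  end of the bridge is minimal on the other side. By \<open>farness_lower_bound\<close> this alone determines
  the structure, including the fact that all pendant nodes hang at the same node.
\<close>

lemma kirchhoff_lower_bound:
  assumes "network V E" "V \<noteq> {}"
  shows "kirchhoff V E \<ge> kirchhoff_bound (card V) (card (bridges E)) \<and>
    (kirchhoff V E = kirchhoff_bound (card V) (card (bridges E)) \<longrightarrow>
      (\<exists>c P. star_of_clique V E c P \<and> card P = card (bridges E)))"
  using assms
proof (induction "card V" arbitrary: V E rule: less_induct)
  case less
  interpret network V E by fact
  show ?case
  proof (cases "bridges E = {}")
    case True
    have "kirchhoff_bound (card V) (card (bridges E)) = real (card V) - 1"
      using True less.prems(2) finite_V by (simp add: kirchhoff_bound_def)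
    moreover obtain v where "v \<in> V" using less.prems(2) by blast
    ultimately show ?thesis
      using kirchhoff_ge[OF less.prems(2)] star_of_clique_complete[of v V E] True
      by (metis card.empty)
  next
    case False
    from bridgeE[OF this] obtain a A EA b B EB where
      j: "bridge_join A EA B EB a b" and V: "V = A \<union> B"
      and E: "E = EA \<union> EB \<union> {(a, b), (b, a)}" .
    interpret J: bridge_join A EA B EB a b by fact
    have net: "network J.V J.E" using less.prems(1) unfolding V E .
    interpret NA: network A EA by (rule J.network_left) fact
    interpret NB: network B EB by (rule J.network_right) fact
    let ?fA = "farness_bound (card A) (card (bridges EA))"
    let ?fB = "farness_bound (card B) (card (bridges EB))"
    let ?kA = "kirchhoff_bound (card A) (card (bridges EA))"
    let ?kB = "kirchhoff_bound (card B) (card (bridges EB))"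
    let ?nA = "real (card A)" and ?nB = "real (card B)"
    have kA: "kirchhoff A EA \<ge> ?kA"
      using less.hyps[of A EA] J.card_sides(5) V NA.network_axioms J.a_in by auto
    have kB: "kirchhoff B EB \<ge> ?kB"
      using less.hyps[of B EB] J.card_sides(6) V NB.network_axioms J.b_in by auto
    have fA: "?nB * farness A EA a \<ge> ?nB * ?fA"
      using farness_lower_bound[OF NA.network_axioms J.a_in] by (simp add: mult_left_mono)
    have fB: "?nA * farness B EB b \<ge> ?nA * ?fB"
      using farness_lower_bound[OF NB.network_axioms J.b_in] by (simp add: mult_left_mono)
    have kf: "kirchhoff V E = kirchhoff A EA + kirchhoff B EB + ?nA * ?nB
        + ?nB * farness A EA a + ?nA * farness B EB b"
      using J.kirchhoff_join[OF net] unfolding V E by simp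
    have "?nA + ?nB \<ge> 0" by simp
    from kirchhoff_bound_join[OF J.card_sides(3,4) this]
    have bound: "kirchhoff_bound (card V) (card (bridges E))
        \<le> ?kA + ?kB + (?nA + ?nB - 1) + ?nB * ?fA + ?nA * ?fB"
      unfolding V E J.card_V J.card_bridges_join of_nat_add by simp
    note prod = add_pred_le_mult[OF J.card_sides(1,2)]
    show ?thesis
    proof (intro conjI impI)
      show "kirchhoff V E \<ge> kirchhoff_bound (card V) (card (bridges E))"
        using bound kA kB fA fB prod(1) unfolding kf by linarith
      assume "kirchhoff V E = kirchhoff_bound (card V) (card (bridges E))"
      then have eq: "?nA * ?nB = ?nA + ?nB - 1" "?nB * farness A EA a = ?nB * ?fA"
        "?nA * farness B EB b = ?nA * ?fB"
        using bound kA kB fA fB prod(1) unfolding kf by linarith+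
      \<comment> \<open>Either side can be the single node, hence a statement for an arbitrary splitting.\<close>
      have star: "\<exists>P. star_of_clique V E c P \<and> card P = card (bridges E)"
        if "bridge_join A' EA' {c'} EB' c c'" "V = A' \<union> {c'}" "E = EA' \<union> EB' \<union> {(c, c'), (c', c)}"
          "farness A' EA' c = farness_bound (card A') (card (bridges EA'))" for A' EA' EB' c c'
      proof -
        interpret J': bridge_join A' EA' "{c'}" EB' c c' by fact
        interpret NA': network A' EA'
          by (rule J'.network_left) (use less.prems(1) that(2,3) in simp)
        from farness_lower_bound[OF NA'.network_axioms J'.a_in] that(4)
        obtain P where P: "star_of_clique A' EA' c P" "card P = card (bridges EA')" by auto
        have "star_of_clique V E c (insert c' P)"
          using J'.star_of_clique_attach[OF P(1) refl] unfolding that(2,3) .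
        moreover have "P \<subseteq> A'" using P(1) by (simp add: star_of_clique_def)
        then have "c' \<notin> P" "finite P" using J'.b_notin J'.A.finite_V by (auto intro: finite_subset)
        then have "card (insert c' P) = card (bridges E)"
          using P(2) J'.card_bridges_join J'.B.bridges_singleton_graph unfolding that(3) by simp
        ultimately show ?thesis by blast
      qed
      from prod(2)[OF eq(1)] show "\<exists>c P. star_of_clique V E c P \<and> card P = card (bridges E)"
      proof
        assume "card B = 1"
        then have B: "B = {b}" by (rule J.trivial_side)
        have "farness A EA a = ?fA" using eq(2) J.card_sides(2) by simp
        then show ?thesis using star[of A EA b EB a] j V E unfolding B by blast
      next
        assume "card A = 1"
        then have A: "A = {a}" by (rule bridge_join.trivial_side[OF J.flip])
        have "farness B EB b = ?fB" using eq(3) J.card_sides(1) by simp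
        moreover have "V = B \<union> {a}" "E = EB \<union> EA \<union> {(b, a), (a, b)}" using V E A by auto
        ultimately show ?thesis using star[of B EB a EA b] J.flip unfolding A by blast
      qed
    qed
  qed
qed

text \<open>
  The pendant nodes are removed one by one; each of them is joined by a bridge to a smaller graph of
  the same kind with the same centre.
\<close>

lemma star_of_clique_values:
  assumes "network V E" "star_of_clique V E c P"
  shows "farness V E c = farness_bound (card V) (card P) \<and>
    kirchhoff V E = kirchhoff_bound (card V) (card P)"
  using assms
proof (induction "card P" arbitrary: V E P)
  case 0
  interpret network V E by fact
  have "finite P" using 0 finite_V by (auto simp: star_of_clique_def intro: finite_subset)
  then have "P = {}" using 0 by simp
  then have c: "c \<in> V" and E: "E = {(x, y). x \<in> V \<and> y \<in> V \<and> x \<noteq> y}"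
    using 0 by (auto simp: star_of_clique_def)
  have n: "card V > 0" using c finite_V by (auto simp: card_gt_0_iff)
  have far: "farness V E v = 2 - 2 / card V" if v: "v \<in> V" for v
  proof -
    have "farness V E v = (\<Sum>i\<in>V - {v}. 2 / card V)"
      unfolding farness_def using v finite_V resistance_self complete_resistance[OF E]
      by (simp add: sum.remove[of V v])
    then show ?thesis using v n by (simp add: field_simps of_nat_diff)
  qed
  have "kirchhoff V E = real (card V) - 1"
    using n by (simp add: kirchhoff_eq_sum_farness far right_diff_distrib)
  then show ?case
    using far[OF c] n \<open>P = {}\<close> by (simp add: farness_bound_def kirchhoff_bound_def)
next
  case (Suc k)
  interpret network V E by fact
  obtain p where p: "p \<in> P" using Suc.hyps(2) by (metis card.empty ex_in_conv nat.distinct(1))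
  have fP: "finite P" using Suc.prems finite_V by (auto simp: star_of_clique_def intro: finite_subset)
  define A where "A = V - {p}"
  define EA where "EA = E \<inter> A \<times> A"
  have c: "c \<in> V" "c \<notin> P" "P \<subseteq> V" using Suc.prems(2) by (auto simp: star_of_clique_def)
  have VP: "A - (P - {p}) = V - P" using p by (auto simp: A_def)
  have EA: "star_of_clique A EA c (P - {p})"
    using Suc.prems(2) p unfolding star_of_clique_def VP by (auto simp: EA_def A_def)
  have V: "V = A \<union> {p}" using p c by (auto simp: A_def)
  have E: "E = EA \<union> {} \<union> {(c, p), (p, c)}"
    using Suc.prems(2) p unfolding star_of_clique_def by (auto simp: EA_def A_def)
  interpret J: bridge_join A EA "{p}" "{}" c p
    using finite_V E_sym E_irrefl c p by unfold_locales (auto simp: A_def EA_def)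
  have net: "network J.V J.E" using Suc.prems(1) using V E by simp
  interpret NA: network A EA by (rule J.network_left) fact
  interpret NB: network "{p}" "{}" by (rule J.network_right) fact
  have k: "k = card (P - {p})" using Suc.hyps(2) p fP by simp
  from Suc.hyps(1)[OF k NA.network_axioms EA]
  have IH: "farness A EA c = farness_bound (card A) k" "kirchhoff A EA = kirchhoff_bound (card A) k"
    using k by auto
  have triv: "farness {p} {} p = 0" "kirchhoff {p} {} = 0"
    using J.B.resistance_self by (auto simp: farness_def kirchhoff_def)
  have card: "card V = card A + 1" using J.card_V V by simp
  have far: "farness V E c = farness_bound (card A) k + 1"
    using J.farness_left[OF net J.a_in] IH triv J.A.resistance_self[OF J.a_in] V E by simp
  have kf: "kirchhoff V E = kirchhoff_bound (card A) k + card A + farness_bound (card A) k"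
    using J.kirchhoff_join[OF net] IH triv V E by simp
  have P: "real (card P) = k + 1" using Suc.hyps(2) by simp
  show ?case
    unfolding far kf P card of_nat_add of_nat_1
    using farness_bound_attach kirchhoff_bound_attach by simp
qed

section \<open>Inverse eigenvalues and the trace\<close>

text \<open>
  The Hermitian form \<open>q\<close> of an eigenvector is its own conjugate and equals the eigenvalue times a
  positive real number.
\<close>

lemma symmetric_eigenvalue_real:
  fixes A :: "real mat"
  assumes A: "A \<in> carrier_mat n n" and sym: "\<And>i j. i < n \<Longrightarrow> j < n \<Longrightarrow> A $$ (i, j) = A $$ (j, i)"
    and ev: "eigenvalue (map_mat complex_of_real A) e"
  shows "e \<in> \<real>"
proof -
  obtain z where z: "z \<in> carrier_vec n" "z \<noteq> 0\<^sub>v n"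
    and Az: "map_mat complex_of_real A *\<^sub>v z = e \<cdot>\<^sub>v z"
    using ev A by (auto simp: eigenvalue_def eigenvector_def)
  define q where "q = (\<Sum>i<n. \<Sum>j<n. cnj (z $ i) * of_real (A $$ (i, j)) * z $ j)"
  define s where "s = (\<Sum>i<n. (cmod (z $ i))\<^sup>2)"
  have row: "(\<Sum>j<n. of_real (A $$ (i, j)) * z $ j) = e * z $ i" if "i < n" for i
    using arg_cong[OF Az, of "\<lambda>x. x $ i"] that A z(1)
    by (simp add: scalar_prod_def row_def lessThan_atLeast0)
  have "q = (\<Sum>i<n. cnj (z $ i) * (e * z $ i))"
    unfolding q_def by (rule sum.cong) (simp_all add: row[symmetric] sum_distrib_left mult.assoc)
  also have "\<dots> = e * of_real s"
    unfolding s_def of_real_sum sum_distrib_left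
    by (rule sum.cong) (simp_all add: complex_norm_square ac_simps del: of_real_power)
  finally have q: "q = e * of_real s" .
  have "cnj q = (\<Sum>i<n. \<Sum>j<n. cnj (z $ j) * of_real (A $$ (j, i)) * z $ i)"
    unfolding q_def by (simp add: sym ac_simps)
  also have "\<dots> = q"
    unfolding q_def by (rule sum.swap)
  finally have "cnj e * of_real s = e * of_real s"
    using q by simp
  moreover have "s \<noteq> 0"
  proof
    assume "s = 0"
    then have "\<forall>i<n. z $ i = 0"
      unfolding s_def by (subst (asm) sum_nonneg_eq_0_iff) auto
    then have "z = 0\<^sub>v n" using z(1) by (intro eq_vecI) auto
    then show False using z(2) by simp
  qed
  ultimately have "cnj e = e" by simp
  then show ?thesis using Reals_cnj_iff by blast
qed

lemma symmetric_char_poly_splits: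
  fixes A :: "real mat"
  assumes A: "A \<in> carrier_mat n n" and sym: "\<And>i j. i < n \<Longrightarrow> j < n \<Longrightarrow> A $$ (i, j) = A $$ (j, i)"
  shows "\<exists>es. char_poly A = (\<Prod>e\<leftarrow>es. [:- e, 1:])"
proof -
  let ?C = "map_mat complex_of_real A"
  have C: "?C \<in> carrier_mat n n" using A by simp
  obtain as where as: "char_poly ?C = (\<Prod>a\<leftarrow>as. [:- a, 1:])"
    using char_poly_factorized[OF C] by blast
  have real: "a \<in> \<real>" if "a \<in> set as" for a
  proof -
    have "poly (char_poly ?C) a = 0"
      using that unfolding as by (auto simp: poly_prod_list prod_list_zero_iff)
    then have "eigenvalue ?C a" using eigenvalue_root_char_poly[OF C] by simp
    then show ?thesis using symmetric_eigenvalue_real[OF A sym] by blast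
  qed
  define es where "es = map Re as"
  have as_es: "as = map of_real es"
    unfolding es_def map_map by (rule map_idI[symmetric]) (use real in \<open>auto simp: Reals_def\<close>)
  interpret mp: map_poly_inj_comm_ring_hom complex_of_real ..
  have "map_poly complex_of_real (\<Prod>e\<leftarrow>es. [:- e, 1:]) = (\<Prod>a\<leftarrow>map of_real es. [:- a, 1:])" for es
    by (induction es) (simp_all add: hom_distribs)
  then have "map_poly complex_of_real (char_poly A) = map_poly complex_of_real (\<Prod>e\<leftarrow>es. [:- e, 1:])"
    unfolding of_real_hom.char_poly_hom[OF A, symmetric] as as_es by simp
  then have "char_poly A = (\<Prod>e\<leftarrow>es. [:- e, 1:])" by simp
  then show ?thesis ..
qed

lemma proots_linear_factors: "proots (\<Prod>e\<leftarrow>es. [:- e, 1:]) = mset (es :: real list)"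
proof (induction es)
  case (Cons e es)
  have "(\<Prod>e\<leftarrow>es. [:- e, 1:]) \<noteq> 0"
    by (auto simp: prod_list_zero_iff)
  then have "proots ([:- e, 1:] * (\<Prod>e\<leftarrow>es. [:- e, 1:])) = proots [:- e, 1:] + proots (\<Prod>e\<leftarrow>es. [:- e, 1:])"
    by (intro proots_mult) auto
  then show ?case using Cons by simp
qed simp

text \<open>
  Column by column, \<open>C * T = 1\<close> forces \<open>C\<close> to be upper triangular as well; then the diagonal entries
  of the product are products of diagonal entries.
\<close>

lemma inverse_upper_triangular_diag:
  fixes T C :: "real mat"
  assumes T: "T \<in> carrier_mat n n" and C: "C \<in> carrier_mat n n"
    and CT: "C * T = 1\<^sub>m n" and tri: "upper_triangular T" and i: "i < n"
  shows "C $$ (i, i) = inverse (T $$ (i, i))"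
proof -
  have ent: "(\<Sum>k<n. C $$ (p, k) * T $$ (k, q)) = of_bool (p = q)" if "p < n" "q < n" for p q
    using arg_cong[OF CT, of "\<lambda>M. M $$ (p, q)"] that T C
    by (simp add: scalar_prod_def lessThan_atLeast0)
  have low: "T $$ (k, q) = 0" if "q < k" "k < n" for k q
    using tri that T by (auto simp: upper_triangular_def)
  have col: "C $$ (p, q) * T $$ (q, q) = of_bool (p = q)"
    if "p < n" "q < n" "\<And>k. k < q \<Longrightarrow> C $$ (p, k) = 0" for p q
  proof -
    have "(\<Sum>k<n. C $$ (p, k) * T $$ (k, q)) = (\<Sum>k<n. if k = q then C $$ (p, q) * T $$ (q, q) else 0)"
    proof (rule sum.cong)
      fix k assume "k \<in> {..<n}"
      then show "C $$ (p, k) * T $$ (k, q) = (if k = q then C $$ (p, q) * T $$ (q, q) else 0)"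
        using low[of q k] that(3)[of k] by (cases k q rule: linorder_cases) auto
    qed simp
    then show ?thesis using ent[OF that(1,2)] that(2) by simp
  qed
  have zero: "\<forall>p. q < p \<and> p < n \<longrightarrow> C $$ (p, q) = 0" for q
  proof (induction q rule: less_induct)
    case (less q)
    show ?case
    proof (intro allI impI)
      fix p assume p: "q < p \<and> p < n"
      have "C $$ (q, q) * T $$ (q, q) = 1"
        using col[of q q] less p by simp
      moreover have "C $$ (p, q) * T $$ (q, q) = 0"
        using col[of p q] less p by simp
      ultimately show "C $$ (p, q) = 0" by auto
    qed
  qed
  have "C $$ (i, i) * T $$ (i, i) = 1"
    using col[of i i] zero i by simp
  then show ?thesis by (metis inverse_unique mult.commute)
qed

lemma index_mult_sum:
  assumes "A \<in> carrier_mat n n" "B \<in> carrier_mat n n" "i < n" "j < n"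
  shows "(A * B) $$ (i, j) = (\<Sum>k<n. A $$ (i, k) * B $$ (k, j))"
  using assms by (simp add: scalar_prod_def lessThan_atLeast0)

lemma trace_mult_commute:
  fixes A B :: "real mat"
  assumes "A \<in> carrier_mat n n" "B \<in> carrier_mat n n"
  shows "(\<Sum>i<n. (A * B) $$ (i, i)) = (\<Sum>i<n. (B * A) $$ (i, i))"
proof -
  have "(\<Sum>i<n. (A * B) $$ (i, i)) = (\<Sum>i<n. \<Sum>k<n. A $$ (i, k) * B $$ (k, i))"
    using assms by (simp add: index_mult_sum del: index_mult_mat)
  also have "\<dots> = (\<Sum>k<n. \<Sum>i<n. A $$ (i, k) * B $$ (k, i))"
    by (rule sum.swap)
  also have "\<dots> = (\<Sum>k<n. (B * A) $$ (k, k))"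
    using assms by (simp add: index_mult_sum mult.commute del: index_mult_mat)
  finally show ?thesis .
qed

definition averaging_mat :: "nat \<Rightarrow> real mat" where
  "averaging_mat n = mat n n (\<lambda>_. 1 / real n)"

lemma averaging_mat_carrier [simp]: "averaging_mat n \<in> carrier_mat n n"
  and averaging_mat_index [simp]: "i < n \<Longrightarrow> j < n \<Longrightarrow> averaging_mat n $$ (i, j) = 1 / real n"
  and averaging_mat_dim [simp]: "dim_row (averaging_mat n) = n" "dim_col (averaging_mat n) = n"
  by (simp_all add: averaging_mat_def)

text \<open>
  A symmetric matrix \<open>L\<close> whose kernel is spanned by the constant vectors is made invertible by adding
  the projection onto its kernel; this replaces the eigenvalue \<open>0\<close> by \<open>1\<close> and keeps the others.
\<close>

locale centred_inverse =
  fixes n :: nat and L K :: "real mat"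
  assumes n_pos: "n > 0"
    and L_carrier: "L \<in> carrier_mat n n" and K_carrier: "K \<in> carrier_mat n n"
    and L_sym: "i < n \<Longrightarrow> j < n \<Longrightarrow> L $$ (i, j) = L $$ (j, i)"
    and row_sum: "i < n \<Longrightarrow> (\<Sum>j<n. L $$ (i, j)) = 0"
    and kernel: "(\<And>i. i < n \<Longrightarrow> (\<Sum>j<n. L $$ (i, j) * x j) = 0) \<Longrightarrow> i < n \<Longrightarrow> j < n \<Longrightarrow> x i = x j"
    and K_inverse: "K * (L + averaging_mat n) = 1\<^sub>m n"
begin

lemma spectrum_zero_first:
  "\<exists>es. char_poly L = (\<Prod>e\<leftarrow>0 # es. [:- e, 1:])"
proof -
  obtain es where es: "char_poly L = (\<Prod>e\<leftarrow>es. [:- e, 1:])"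
    using symmetric_char_poly_splits[OF L_carrier L_sym] by blast
  define u where "u = vec n (\<lambda>_. 1 :: real)"
  have "u $ 0 \<noteq> 0\<^sub>v n $ 0" using n_pos by (simp add: u_def)
  then have "u \<noteq> 0\<^sub>v n" by auto
  moreover have "L *\<^sub>v u = 0 \<cdot>\<^sub>v u"
    by (rule eq_vecI) (use L_carrier row_sum in \<open>auto simp: u_def scalar_prod_def lessThan_atLeast0\<close>)
  ultimately have "eigenvalue L 0"
    using L_carrier unfolding eigenvalue_def eigenvector_def by (intro exI[of _ u]) (auto simp: u_def)
  then have "poly (char_poly L) 0 = 0" using eigenvalue_root_char_poly[OF L_carrier] by simp
  then have zero: "0 \<in> set es" unfolding es by (auto simp: poly_prod_list prod_list_zero_iff)
  have "mset (0 # remove1 0 es) = mset es" using zero by simp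
  then have "mset (map (\<lambda>e. [:- e, 1:]) (0 # remove1 0 es)) = mset (map (\<lambda>e. [:- e, 1:]) es)"
    by (simp only: mset_map)
  then have "(\<Prod>e\<leftarrow>0 # remove1 0 es. [:- e, 1:]) = (\<Prod>e\<leftarrow>es. [:- e, 1:])"
    by (metis prod_mset_prod_list)
  then show ?thesis using es by metis
qed

text \<open>
  A triangularisation that begins with the eigenvalue \<open>0\<close> has a constant vector as the first column
  of \<open>P\<close>. In this basis the averaging matrix has only its first row nonzero, with \<open>1\<close> at the corner.
  Hence \<open>L + averaging_mat n\<close> becomes upper triangular with \<open>1\<close> and the remaining eigenvalues on
  the diagonal, and the diagonal of the conjugated inverse can be read off.
\<close>

lemma sum_inverse_spectrum:
  assumes cp: "char_poly L = (\<Prod>e\<leftarrow>0 # es. [:- e, 1:])"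
  shows "(\<Sum>e\<leftarrow>es. inverse e) = (\<Sum>i<n. K $$ (i, i)) - 1"
proof -
  obtain T P Q where "schur_decomposition L (0 # es) = (T, P, Q)"
    by (metis prod_cases3)
  from schur_decomposition[OF L_carrier cp this]
  have sim: "similar_mat_wit L T P Q" and tri: "upper_triangular T" and diag: "diag_mat T = 0 # es"
    by auto
  note [simp] = L_carrier K_carrier
  from similar_mat_witD2[OF L_carrier sim]
  have PQ: "P * Q = 1\<^sub>m n" and QP: "Q * P = 1\<^sub>m n" and LPTQ: "L = P * T * Q"
    and [simp]: "T \<in> carrier_mat n n" "P \<in> carrier_mat n n" "Q \<in> carrier_mat n n" by auto
  have low: "T $$ (k, q) = 0" if "q < k" "k < n" for k q
    using tri that carrier_matD(1)[of T n n] by (simp add: upper_triangular_def)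
  have T_diag: "T $$ (i, i) = (0 # es) ! i" if "i < n" for i
    using that unfolding diag[symmetric] by (simp add: diag_mat_def carrier_matD(1)[of T n n])
  have len: "length (0 # es) = n"
    unfolding diag[symmetric] by (simp add: diag_mat_def carrier_matD(1)[of T n n])
  have LP: "L * P = P * T"
  proof -
    have "L * P = P * T * (Q * P)" unfolding LPTQ
      by (simp add: assoc_mult_mat[of _ n n _ n _ n] mult_carrier_mat[of _ n n])
    then show ?thesis by (simp add: QP right_mult_one_mat[of _ n n] mult_carrier_mat[of _ n n])
  qed
  define c where "c = P $$ (0, 0)"
  have P0: "P $$ (i, 0) = c" if "i < n" for i
    unfolding c_def
  proof (rule kernel[of "\<lambda>i. P $$ (i, 0)", OF _ that n_pos])
    fix i assume i: "i < n"
    have "(\<Sum>j<n. L $$ (i, j) * P $$ (j, 0)) = (L * P) $$ (i, 0)"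
      by (rule index_mult_sum[symmetric]) (simp_all add: i n_pos)
    also have "\<dots> = (\<Sum>k<n. P $$ (i, k) * T $$ (k, 0))"
      unfolding LP by (rule index_mult_sum) (simp_all add: i n_pos)
    also have "\<dots> = 0"
    proof (rule sum.neutral, rule ballI)
      fix k assume k: "k \<in> {..<n}"
      then show "P $$ (i, k) * T $$ (k, 0) = 0"
        using low[of 0 k] T_diag[of 0] n_pos by (cases "k = 0") auto
    qed
    finally show "(\<Sum>j<n. L $$ (i, j) * P $$ (j, 0)) = 0" .
  qed
  have Q_row: "(\<Sum>i<n. Q $$ (j, i)) * c = of_bool (j = 0)" if "j < n" for j
  proof -
    have "(\<Sum>i<n. Q $$ (j, i)) * c = (\<Sum>i<n. Q $$ (j, i) * P $$ (i, 0))"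
      using P0 by (simp add: sum_distrib_right)
    also have "\<dots> = (Q * P) $$ (j, 0)"
      by (rule index_mult_sum[symmetric]) (simp_all add: that n_pos)
    finally show ?thesis using that n_pos unfolding QP by simp
  qed
  have c: "c \<noteq> 0" using Q_row[OF n_pos] by auto
  \<comment> \<open>The averaging matrix in the new basis.\<close>
  define N where "N = Q * averaging_mat n * P"
  have N_car[simp]: "N \<in> carrier_mat n n" by (simp add: N_def mult_carrier_mat[of _ n n])
  have N: "N $$ (j, k) = (\<Sum>i<n. Q $$ (j, i)) * (\<Sum>l<n. P $$ (l, k) / n)" if "j < n" "k < n" for j k
  proof -
    have "(Q * averaging_mat n) $$ (j, l) = (\<Sum>i<n. Q $$ (j, i)) / n" if "l < n" for l
      using that(1)
      by (subst index_mult_sum[of Q n]) (simp_all add: \<open>j < n\<close> sum_divide_distrib)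
    then show ?thesis
      using that unfolding N_def
      by (subst index_mult_sum[of "Q * averaging_mat n" n])
        (simp_all add: mult_carrier_mat[of _ n n] sum_distrib_left del: index_mult_mat)
  qed
  have N_low: "N $$ (j, k) = 0" if "j < n" "k < n" "j > 0" for j k
    using N[OF that(1,2)] Q_row[OF that(1)] c that(3) by simp
  have N00: "N $$ (0, 0) = 1"
    using N[OF n_pos n_pos] Q_row[OF n_pos] P0 n_pos by simp
  \<comment> \<open>The inverse of the shifted matrix in the new basis.\<close>
  define C where "C = Q * K * P"
  have C_car[simp]: "C \<in> carrier_mat n n" by (simp add: C_def mult_carrier_mat[of _ n n])
  have TN: "T + N = Q * ((L + averaging_mat n) * P)"
  proof -
    have "Q * (L * P) = T"
      unfolding LP by (simp add: assoc_mult_mat[symmetric, of _ n n _ n _ n] QP left_mult_one_mat[of _ n n])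
    then show ?thesis
      unfolding N_def
      by (simp add: add_mult_distrib_mat[of _ n n _ _ n] mult_add_distrib_mat[of _ n n _ n]
          assoc_mult_mat[of _ n n _ n _ n] mult_carrier_mat[of _ n n])
  qed
  have "C * (T + N) = Q * (K * ((P * Q) * ((L + averaging_mat n) * P)))"
    unfolding C_def TN
    by (simp add: assoc_mult_mat[of _ n n _ n _ n] mult_carrier_mat[of _ n n] add_carrier_mat)
  also have "\<dots> = Q * ((K * (L + averaging_mat n)) * P)"
    unfolding PQ
    by (simp add: assoc_mult_mat[of _ n n _ n _ n] mult_carrier_mat[of _ n n] add_carrier_mat left_mult_one_mat[of _ n n])
  also have "\<dots> = 1\<^sub>m n"
    using K_inverse by (simp add: QP left_mult_one_mat[of _ n n])
  finally have CTN: "C * (T + N) = 1\<^sub>m n" .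
  have tri': "upper_triangular (T + N)"
    unfolding upper_triangular_def using low N_low
    by (auto simp: index_add_mat carrier_matD[OF N_car])
  have C_diag: "C $$ (i, i) = inverse ((T + N) $$ (i, i))" if "i < n" for i
    using inverse_upper_triangular_diag[OF _ C_car CTN tri' that] by (simp add: add_carrier_mat)
  have "(\<Sum>i<n. K $$ (i, i)) = (\<Sum>i<n. C $$ (i, i))"
  proof -
    have "(\<Sum>i<n. C $$ (i, i)) = (\<Sum>i<n. (P * (Q * K)) $$ (i, i))"
      unfolding C_def by (rule trace_mult_commute) (simp_all add: mult_carrier_mat[of _ n n])
    also have "P * (Q * K) = K"
      by (simp add: assoc_mult_mat[symmetric, of _ n n _ n _ n] PQ left_mult_one_mat[of _ n n])
    finally show ?thesis by simp
  qed
  also have "\<dots> = (\<Sum>i<n. if i = 0 then 1 else inverse ((0 # es) ! i))"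
  proof (rule sum.cong)
    fix i assume "i \<in> {..<n}"
    then have i: "i < n" by simp
    then have "(T + N) $$ (i, i) = T $$ (i, i) + N $$ (i, i)"
      by (simp add: carrier_matD[OF N_car])
    then show "C $$ (i, i) = (if i = 0 then 1 else inverse ((0 # es) ! i))"
      using C_diag[OF i] T_diag[OF i] N_low[OF i i] N00 by auto
  qed simp
  also have "\<dots> = 1 + (\<Sum>i<length es. inverse (es ! i))"
    unfolding len[symmetric] by (simp add: sum.lessThan_Suc_shift del: sum.lessThan_Suc)
  also have "(\<Sum>i<length es. inverse (es ! i)) = (\<Sum>e\<leftarrow>es. inverse e)"
    by (simp add: sum_list_sum_nth lessThan_atLeast0)
  finally show ?thesis by simp
qed

end

text \<open>
  As all eigenvalues are nonnegative, the smallest one is the eigenvalue \<open>0\<close> in front of the list,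
  and the sum from index \<open>2\<close> on omits exactly it.
\<close>

lemma (in centred_inverse) sum_eigval:
  assumes cp: "char_poly L = (\<Prod>e\<leftarrow>0 # es. [:- e, 1:])" and nonneg: "\<And>e. e \<in> set es \<Longrightarrow> 0 \<le> e"
  shows "(\<Sum>i = 2..n. inverse (eigval L i)) = (\<Sum>e\<leftarrow>es. inverse e)"
proof -
  define s where "s = sort es"
  have "sorted_list_of_multiset (proots (char_poly L)) = sort (0 # es)"
    unfolding cp proots_linear_factors by simp
  also have "\<dots> = 0 # s"
    unfolding s_def using nonneg by (simp add: insort_is_Cons)
  finally have eigval: "eigval L i = (0 # s) ! (i - 1)" for i
    by (simp add: eigval_def)
  have "length (0 # es) = n"
  proof -
    have "degree (\<Prod>e\<leftarrow>0 # es. [:- e, 1:]) = length (0 # es)"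
      using degree_linear_factors[of uminus "0 # es"] by simp
    then show ?thesis using degree_monic_char_poly[OF L_carrier] cp by simp
  qed
  then have len: "n = Suc (length s)" by (simp add: s_def)
  have "(\<Sum>i = 2..n. inverse (eigval L i)) = (\<Sum>k<length s. inverse (s ! k))"
    by (rule sum.reindex_bij_witness[of _ "\<lambda>k. k + 2" "\<lambda>i. i - 2"])
      (auto simp: eigval len nth_Cons' numeral_2_eq_2)
  also have "\<dots> = (\<Sum>e\<leftarrow>s. inverse e)"
    by (simp add: sum_list_sum_nth lessThan_atLeast0)
  also have "\<dots> = (\<Sum>e\<leftarrow>es. inverse e)"
    unfolding s_def by (metis mset_map mset_sort sum_mset_sum_list)
  finally show ?thesis .
qed

section \<open>The Laplacian matrix of a connected graph\<close>

locale labelled_graph = simple_graph "{0..<n}" E for n :: nat and E +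
  fixes L :: "real mat"
  assumes n_pos: "n > 0"
    and connected: "i < n \<Longrightarrow> j < n \<Longrightarrow> (i, j) \<in> E\<^sup>*"
    and L_def: "L = mat n n (\<lambda>(i, j). (if i = j then real (card (E `` {i})) else 0) - of_bool ((i, j) \<in> E))"
begin

lemma L_carrier: "L \<in> carrier_mat n n"
  by (simp add: L_def)

lemma L_apply:
  assumes "i < n"
  shows "(\<Sum>j<n. L $$ (i, j) * x j) = net_laplacian E x i"
proof -
  have sub: "E `` {i} \<subseteq> {..<n}" using E_subset by auto
  have "(\<Sum>j<n. L $$ (i, j) * x j)
      = (\<Sum>j<n. card (E `` {i}) * x j * of_bool (j = i) - (if j \<in> E `` {i} then x j else 0))"
    by (rule sum.cong) (use assms in \<open>auto simp: L_def algebra_simps\<close>)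
  also have "\<dots> = card (E `` {i}) * x i - (\<Sum>j<n. if j \<in> E `` {i} then x j else 0)"
    unfolding sum_subtractf using assms sum_mult_of_bool[of "{..<n}" i "\<lambda>j. card (E `` {i}) * x j"] by simp
  also have "(\<Sum>j<n. if j \<in> E `` {i} then x j else 0) = (\<Sum>j\<in>{..<n} \<inter> E `` {i}. x j)"
    by (rule sum.inter_restrict[symmetric]) simp
  also have "{..<n} \<inter> E `` {i} = E `` {i}" using sub by blast
  finally show ?thesis
    using finite_nbrs by (simp add: net_laplacian_def sum_subtractf)
qed

lemma energy_zero_constant:
  assumes "(\<Sum>v<n. x v * net_laplacian E x v) = 0" "i < n" "j < n"
  shows "x i = x j"
proof -
  have "(\<Sum>(v, w)\<in>E. (x v - x w) * (x v - x w)) = 0"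
    using green[of x x] assms(1) by (simp add: lessThan_atLeast0)
  then have "\<forall>e\<in>E. (case e of (v, w) \<Rightarrow> (x v - x w) * (x v - x w)) = 0"
    using finite_E by (subst (asm) sum_nonneg_eq_0_iff) auto
  then have edge: "x v = x w" if "(v, w) \<in> E" for v w using that by auto
  from connected[OF assms(2,3)] show ?thesis
    by induction (auto dest: edge)
qed

text \<open>
  A vector in the kernel satisfies \<open>L x = - m\<close> at every node, where \<open>m\<close> is its mean. Summing over
  the nodes gives \<open>m = 0\<close>; hence the energy of \<open>x\<close> vanishes and \<open>x\<close> is constant with mean \<open>0\<close>.
\<close>

lemma shifted_invertible:
  "\<exists>K. K \<in> carrier_mat n n \<and> (L + averaging_mat n) * K = 1\<^sub>m n \<and>
    K * (L + averaging_mat n) = 1\<^sub>m n"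
proof -
  have car: "L + averaging_mat n \<in> carrier_mat n n" using L_carrier by simp
  have "det (L + averaging_mat n) \<noteq> 0"
  proof
    assume "det (L + averaging_mat n) = 0"
    then obtain v where v: "v \<in> carrier_vec n" "v \<noteq> 0\<^sub>v n" and Lv: "(L + averaging_mat n) *\<^sub>v v = 0\<^sub>v n"
      using det_0_iff_vec_prod_zero_field[OF car] by blast
    define x where "x i = v $ i" for i
    have eq: "net_laplacian E x i + (\<Sum>j<n. x j) / n = 0" if "i < n" for i
    proof -
      have "0 = ((L + averaging_mat n) *\<^sub>v v) $ i" using Lv that by simp
      also have "\<dots> = (\<Sum>j<n. L $$ (i, j) * x j + x j / n)"
        using that v(1) carrier_matD[OF L_carrier]
        by (simp add: scalar_prod_def x_def lessThan_atLeast0 algebra_simps)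
      finally show ?thesis using L_apply[OF that] by (simp add: sum.distrib sum_divide_distrib)
    qed
    have "0 = (\<Sum>i<n. net_laplacian E x i + (\<Sum>j<n. x j) / n)" using eq by simp
    also have "\<dots> = (\<Sum>j<n. x j)"
      using sum_net_laplacian[of x] n_pos by (simp add: sum.distrib lessThan_atLeast0)
    finally have sum0: "(\<Sum>j<n. x j) = 0" by simp
    then have "(\<Sum>i<n. x i * net_laplacian E x i) = 0" using eq by (intro sum.neutral) simp
    then have const: "x j = x i" if "i < n" "j < n" for i j using energy_zero_constant that by blast
    have "x i = 0" if "i < n" for i
    proof -
      have "(\<Sum>j<n. x j) = n * x i" using const[OF that] by simp
      then show ?thesis using sum0 n_pos by simp
    qed
    then have "v = 0\<^sub>v n" using v(1) by (intro eq_vecI) (auto simp: x_def)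
    then show False using v(2) by simp
  qed
  from det_non_zero_imp_unit[OF car this, of "()"] show ?thesis
    unfolding Units_def ring_mat_def by auto
qed

definition K where
  "K = (SOME K. K \<in> carrier_mat n n \<and> (L + averaging_mat n) * K = 1\<^sub>m n \<and>
    K * (L + averaging_mat n) = 1\<^sub>m n)"

lemma K:
  "K \<in> carrier_mat n n" "(L + averaging_mat n) * K = 1\<^sub>m n" "K * (L + averaging_mat n) = 1\<^sub>m n"
  using someI_ex[OF shifted_invertible] unfolding K_def[symmetric] by auto

text \<open>
  \<open>K\<close> inverts the Laplacian up to constants, and its columns sum to \<open>1\<close>.
\<close>

lemma K_column:
  assumes "i < n" "v < n"
  shows "net_laplacian E (\<lambda>x. K $$ (x, i)) v = of_bool (v = i) - 1 / n"
    and "(\<Sum>x<n. K $$ (x, i)) = 1"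
proof -
  have eq: "net_laplacian E (\<lambda>x. K $$ (x, i)) v + (\<Sum>x<n. K $$ (x, i)) / n = of_bool (v = i)"
    if "v < n" for v
  proof -
    have "of_bool (v = i) = ((L + averaging_mat n) * K) $$ (v, i)" using K(2) that assms by simp
    also have "\<dots> = (\<Sum>x<n. (L + averaging_mat n) $$ (v, x) * K $$ (x, i))"
      using that assms K(1) L_carrier by (intro index_mult_sum) auto
    also have "\<dots> = (\<Sum>x<n. L $$ (v, x) * K $$ (x, i) + K $$ (x, i) / n)"
      using that carrier_matD[OF L_carrier] by (intro sum.cong) (auto simp: algebra_simps)
    finally show ?thesis using L_apply[OF that] by (simp add: sum.distrib sum_divide_distrib)
  qed
  have "(\<Sum>v<n. net_laplacian E (\<lambda>x. K $$ (x, i)) v + (\<Sum>x<n. K $$ (x, i)) / n) = (\<Sum>v<n. 1 * of_bool (v = i))"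
    using eq by simp
  then show 1: "(\<Sum>x<n. K $$ (x, i)) = 1"
    using sum_net_laplacian[of "\<lambda>x. K $$ (x, i)"] n_pos assms sum_mult_of_bool[of "{..<n}" i "\<lambda>_. 1"]
    by (simp add: sum.distrib lessThan_atLeast0)
  show "net_laplacian E (\<lambda>x. K $$ (x, i)) v = of_bool (v = i) - 1 / n"
    using eq[OF assms(2)] 1 by simp
qed

lemma K_potential:
  assumes "i < n" "j < n"
  shows "potential E i j (\<lambda>x. K $$ (x, i) - K $$ (x, j))"
proof -
  have "net_laplacian E (\<lambda>x. K $$ (x, i) - K $$ (x, j)) v
      = net_laplacian E (\<lambda>x. K $$ (x, i)) v - net_laplacian E (\<lambda>x. K $$ (x, j)) v" for v
    unfolding net_laplacian_def sum_subtractf[symmetric] by (simp add: algebra_simps)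
  then have "net_laplacian E (\<lambda>x. K $$ (x, i) - K $$ (x, j)) v = of_bool (v = i) - of_bool (v = j)" if "v < n" for v
    using K_column(1) that assms by simp
  moreover have "net_laplacian E (\<lambda>x. K $$ (x, i) - K $$ (x, j)) v = of_bool (v = i) - of_bool (v = j)" if "\<not> v < n" for v
    using net_laplacian_outside[of v] that assms by auto
  ultimately show ?thesis unfolding potential_def by blast
qed

lemma network: "network {0..<n} E"
  by unfold_locales (use K_potential in auto)

text \<open>
  By \<open>K_potential\<close> the resistance between \<open>i\<close> and \<open>j\<close> is \<open>K(i,i) + K(j,j) - K(i,j) - K(j,i)\<close>,
  and the columns of \<open>K\<close> sum to \<open>1\<close>.
\<close>

lemma kirchhoff_trace: "kirchhoff {0..<n} E = n * ((\<Sum>i<n. K $$ (i, i)) - 1)"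
proof -
  have "resistance E i j = K $$ (i, i) + K $$ (j, j) - K $$ (i, j) - K $$ (j, i)" if "i < n" "j < n" for i j
    using resistance_eq[OF K_potential[OF that]] that by simp
  then have "2 * kirchhoff {0..<n} E
      = (\<Sum>i<n. \<Sum>j<n. K $$ (i, i) + K $$ (j, j) - K $$ (i, j) - K $$ (j, i))"
    unfolding kirchhoff_def by (simp add: lessThan_atLeast0)
  also have "\<dots> = 2 * n * (\<Sum>i<n. K $$ (i, i)) - (\<Sum>i<n. \<Sum>j<n. K $$ (i, j)) - (\<Sum>i<n. \<Sum>j<n. K $$ (j, i))"
    by (simp add: sum.distrib sum_subtractf sum_distrib_left algebra_simps)
  also have "(\<Sum>i<n. \<Sum>j<n. K $$ (i, j)) = (\<Sum>i<n. \<Sum>j<n. K $$ (j, i))"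
    by (rule sum.swap)
  also have "(\<Sum>i<n. \<Sum>j<n. K $$ (j, i)) = n"
    using K_column(2) by simp
  finally show ?thesis by (simp add: algebra_simps)
qed

text \<open>
  The link between the spectrum and the resistances.
\<close>

lemma sum_inverse_eigval: "(\<Sum>i = 2..n. inverse (eigval L i)) = kirchhoff {0..<n} E / n"
proof -
  interpret S: centred_inverse n L K
  proof
    show "n > 0" by (rule n_pos)
    show "L \<in> carrier_mat n n" "K \<in> carrier_mat n n" by (rule L_carrier, rule K(1))
    show "K * (L + averaging_mat n) = 1\<^sub>m n" by (rule K(3))
    show "L $$ (i, j) = L $$ (j, i)" if "i < n" "j < n" for i j
      using that E_sym[of i j] E_sym[of j i] by (auto simp: L_def)
    show "(\<Sum>j<n. L $$ (i, j)) = 0" if "i < n" for i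
      using L_apply[OF that, of "\<lambda>_. 1"] by (simp add: net_laplacian_def)
    show "x i = x j" if "\<And>i. i < n \<Longrightarrow> (\<Sum>j<n. L $$ (i, j) * x j) = 0" "i < n" "j < n" for x i j
      by (rule energy_zero_constant[OF _ that(2,3)]) (use that(1) L_apply in \<open>auto intro!: sum.neutral\<close>)
  qed
  obtain es where cp: "char_poly L = (\<Prod>e\<leftarrow>0 # es. [:- e, 1:])"
    using S.spectrum_zero_first by blast
  have "0 \<le> e" if "e \<in> set es" for e
  proof -
    have "poly (char_poly L) e = 0" using that unfolding cp by (auto simp: poly_prod_list prod_list_zero_iff)
    then have "eigenvalue L e" using eigenvalue_root_char_poly[OF L_carrier] by simp
    then obtain v where v: "v \<in> carrier_vec n" "v \<noteq> 0\<^sub>v n" and Lv: "L *\<^sub>v v = e \<cdot>\<^sub>v v"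
      using carrier_matD[OF L_carrier] by (auto simp: eigenvalue_def eigenvector_def)
    define x where "x i = v $ i" for i
    have "net_laplacian E x i = e * x i" if "i < n" for i
      using arg_cong[OF Lv, of "\<lambda>u. u $ i"] that v(1) carrier_matD[OF L_carrier]
        L_apply[OF that, of x]
      by (simp add: scalar_prod_def x_def lessThan_atLeast0)
    then have "(\<Sum>i<n. x i * net_laplacian E x i) = e * (\<Sum>i<n. (x i)\<^sup>2)"
      by (simp add: sum_distrib_left power2_eq_square algebra_simps)
    then have prod: "e * (\<Sum>i<n. (x i)\<^sup>2) \<ge> 0"
      using energy_nonneg[of x] by (simp add: lessThan_atLeast0)
    have "\<exists>i<n. x i \<noteq> 0"
    proof (rule ccontr)
      assume "\<not> (\<exists>i<n. x i \<noteq> 0)"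
      then have "v = 0\<^sub>v n" using v(1) by (intro eq_vecI) (auto simp: x_def)
      then show False using v(2) by simp
    qed
    then obtain i where "i < n" "x i \<noteq> 0" by blast
    then have "(\<Sum>i<n. (x i)\<^sup>2) > 0" by (intro sum_pos2[of _ i]) auto
    then show ?thesis using prod by (simp add: zero_le_mult_iff)
  qed
  from S.sum_eigval[OF cp this] S.sum_inverse_spectrum[OF cp] show ?thesis
    using n_pos by (simp add: kirchhoff_trace)
qed

end

section \<open>Cut edges and isomorphisms\<close>

lemma reachable_with_proj_iff:
  assumes "parcs H \<subseteq> pverts H \<times> pverts H"
  shows "reachable (with_proj H) x y \<longleftrightarrow> x \<in> pverts H \<and> y \<in> pverts H \<and> (x, y) \<in> (parcs H)\<^sup>*"
proof
  assume "reachable (with_proj H) x y"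
  then show "x \<in> pverts H \<and> y \<in> pverts H \<and> (x, y) \<in> (parcs H)\<^sup>*"
    unfolding reachable_def using in_rtrancl_on_in_F rtrancl_on_rtranclI by (metis with_proj_simps(1,3))
next
  assume "x \<in> pverts H \<and> y \<in> pverts H \<and> (x, y) \<in> (parcs H)\<^sup>*"
  then show "reachable (with_proj H) x y"
    unfolding reachable_def with_proj_simps
    using rtrancl_consistent_rtrancl_on[of x y "parcs H" "pverts H"] assms by blast
qed

lemma num_components_eq_1:
  assumes "parcs H \<subseteq> pverts H \<times> pverts H" "pverts H \<noteq> {}"
    and "\<And>x y. x \<in> pverts H \<Longrightarrow> y \<in> pverts H \<Longrightarrow> (x, y) \<in> (parcs H)\<^sup>*"
  shows "num_components H = 1"
proof -
  have "pre_digraph.sccs_verts (with_proj H) = {pverts H}"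
    unfolding pre_digraph.sccs_verts_def reachable_with_proj_iff[OF assms(1)] using assms(2,3) by auto
  then show ?thesis by (simp add: num_components_def)
qed

lemma num_components_ge_2:
  assumes "parcs H \<subseteq> pverts H \<times> pverts H" "finite (pverts H)" "sym (parcs H)"
    and "u \<in> pverts H" "v \<in> pverts H" "(u, v) \<notin> (parcs H)\<^sup>*"
  shows "num_components H \<ge> 2"
proof -
  let ?S = "pre_digraph.sccs_verts (with_proj H)"
  define C where "C x = {y \<in> pverts H. (x, y) \<in> (parcs H)\<^sup>*}" for x
  have sym: "(y, x) \<in> (parcs H)\<^sup>*" if "(x, y) \<in> (parcs H)\<^sup>*" for x y
    using that assms(3) by (meson symD sym_rtrancl)
  have C: "C x \<in> ?S" if "x \<in> pverts H" for x
    unfolding pre_digraph.sccs_verts_def reachable_with_proj_iff[OF assms(1)] C_def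
    using that by (auto intro: sym rtrancl_trans)
  have "?S \<subseteq> Pow (pverts H)"
    unfolding pre_digraph.sccs_verts_def reachable_with_proj_iff[OF assms(1)] by auto
  then have "finite ?S" using assms(2) by (auto intro: finite_subset)
  moreover have "C u \<noteq> C v" using assms(4-6) by (auto simp: C_def)
  ultimately have "card {C u, C v} \<le> card ?S" using C assms(4,5) by (intro card_mono) auto
  then show ?thesis using \<open>C u \<noteq> C v\<close> by (simp add: num_components_def)
qed

lemma pair_graph_arcs:
  assumes "pair_graph G"
  shows "parcs G \<subseteq> pverts G \<times> pverts G" "sym (parcs G)" "finite (pverts G)" "(x, x) \<notin> parcs G"
proof -
  interpret pair_graph G by fact
  show "parcs G \<subseteq> pverts G \<times> pverts G" using wellformed' by auto
  show "sym (parcs G)" using pair_sym_arcs by (simp add: symmetric_def)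
  show "finite (pverts G)" by (rule pair_finite_verts)
  show "(x, x) \<notin> parcs G" using pair_no_loops by force
qed

lemma connected_pair_graphD:
  assumes "pair_graph G" "connected (with_proj G)"
  shows "pverts G \<noteq> {}"
    and "x \<in> pverts G \<Longrightarrow> y \<in> pverts G \<Longrightarrow> (x, y) \<in> (parcs G)\<^sup>*"
proof -
  have "parcs (mk_symmetric (with_proj G)) = parcs G"
    using pair_graph_arcs(2)[OF assms(1)] by (auto simp: mk_symmetric_def dest: symD)
  moreover have "pverts (mk_symmetric (with_proj G)) = pverts G"
    by (simp add: mk_symmetric_def)
  ultimately have "mk_symmetric (with_proj G) = G" by simp
  then have "strongly_connected (with_proj G)"
    using assms(2) by (simp add: connected_def)
  then show "pverts G \<noteq> {}" "x \<in> pverts G \<Longrightarrow> y \<in> pverts G \<Longrightarrow> (x, y) \<in> (parcs G)\<^sup>*"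
    using reachable_with_proj_iff[OF pair_graph_arcs(1)[OF assms(1)]]
    by (auto simp: strongly_connected_def)
qed

text \<open>
  A connected graph has one component, so a deletion increases the number of components if and only if
  it disconnects the graph, that is, if and only if it separates the ends of the deleted edge.
\<close>

lemma cut_edges_eq_bridges:
  assumes g: "pair_graph G" and conn: "connected (with_proj G)"
  shows "cut_edges G = bridges (parcs G)"
proof -
  note sub = pair_graph_arcs(1)[OF g] and sym = pair_graph_arcs(2)[OF g]
  note ne = connected_pair_graphD(1)[OF g conn] and reach = connected_pair_graphD(2)[OF g conn]
  have one: "num_components G = 1" by (rule num_components_eq_1[OF sub ne reach])
  have "num_components (delete_edge G u v) > 1 \<longleftrightarrow> (u, v) \<notin> (parcs G - {(u, v), (v, u)})\<^sup>*"
    if uv: "(u, v) \<in> parcs G" for u v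
  proof -
    let ?H = "delete_edge G u v"
    have H: "pverts ?H = pverts G" "parcs ?H = parcs G - {(u, v), (v, u)}"
      by (simp_all add: delete_edge_def)
    have subH: "parcs ?H \<subseteq> pverts ?H \<times> pverts ?H" using sub unfolding H by auto
    have symH: "sym (parcs ?H)" using sym unfolding H by (auto simp: sym_def)
    show ?thesis
    proof
      assume "(u, v) \<notin> (parcs G - {(u, v), (v, u)})\<^sup>*"
      then have "num_components ?H \<ge> 2"
        using uv sub pair_graph_arcs(3)[OF g] by (intro num_components_ge_2[OF subH _ symH, of u v]) (auto simp: H)
      then show "num_components ?H > 1" by simp
    next
      assume more: "num_components ?H > 1"
      show "(u, v) \<notin> (parcs G - {(u, v), (v, u)})\<^sup>*"
      proof
        assume r: "(u, v) \<in> (parcs G - {(u, v), (v, u)})\<^sup>*"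
        then have "(v, u) \<in> (parcs ?H)\<^sup>*" using symH unfolding H by (meson symD sym_rtrancl)
        then have "parcs G \<subseteq> (parcs ?H)\<^sup>*" using r unfolding H by auto
        then have "(parcs G)\<^sup>* \<subseteq> (parcs ?H)\<^sup>*" by (metis rtrancl_idemp rtrancl_mono)
        then have "num_components ?H = 1"
          using reach ne by (intro num_components_eq_1[OF subH]) (auto simp: H(1))
        then show False using more by simp
      qed
    qed
  qed
  then show ?thesis unfolding cut_edges_def bridges_def one by blast
qed

lemma star_of_clique_image:
  assumes "star_of_clique V E c P" "inj_on f V"
  shows "star_of_clique (f ` V) (map_prod f f ` E) (f c) (f ` P)"
proof -
  have c: "c \<in> V" "P \<subseteq> V" "c \<notin> P" and E: "E = {(x, y). x \<in> V - P \<and> y \<in> V - P \<and> x \<noteq> y} \<union> {c} \<times> P \<union> P \<times> {c}"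
    using assms(1) by (auto simp: star_of_clique_def)
  have inj: "f x = f y \<longleftrightarrow> x = y" if "x \<in> V" "y \<in> V" for x y
    using assms(2) that by (auto dest: inj_onD)
  have "f c \<notin> f ` P" using inj c by auto
  moreover have "f ` V - f ` P = f ` (V - P)" using assms(2) c(2) by (simp add: inj_on_image_set_diff)
  moreover have "map_prod f f ` {(x, y). x \<in> V - P \<and> y \<in> V - P \<and> x \<noteq> y}
      = {(x, y). x \<in> f ` (V - P) \<and> y \<in> f ` (V - P) \<and> x \<noteq> y}"
    using inj by (auto simp: map_prod_def image_iff)
  moreover have "map_prod f f ` ({c} \<times> P) = {f c} \<times> f ` P" "map_prod f f ` (P \<times> {c}) = f ` P \<times> {f c}"
    by auto
  ultimately show ?thesis
    using c unfolding star_of_clique_def E image_Un by auto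
qed

lemma star_of_clique_clique_star:
  assumes "k < n"
  shows "star_of_clique {0..<n} (parcs (clique_star n k)) 0 {n - k..<n}"
  using assms by (auto simp: star_of_clique_def clique_star_def)

text \<open>
  The centre is sent to \<open>0\<close>, the pendant nodes to the last labels and the remaining nodes of the
  clique to those in between.
\<close>

lemma star_of_clique_bij:
  assumes "star_of_clique {0..<n} E c P"
  shows "\<exists>f. bij_betw f {0..<n} {0..<n} \<and> f c = 0 \<and> f ` P = {n - card P..<n}"
proof -
  let ?k = "card P" and ?V = "{0..<n}"
  have c: "c \<in> ?V" "P \<subseteq> ?V" "c \<notin> P" using assms by (auto simp: star_of_clique_def)
  have fP: "finite P" using c(2) by (auto intro: finite_subset)
  have "card (insert c P) \<le> card ?V" using c by (intro card_mono) auto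
  then have k: "?k < n" using c fP by simp
  have rest: "card (?V - insert c P) = n - Suc ?k"
    using c fP by (subst card_Diff_subset) auto
  obtain g where g: "bij_betw g P {n - ?k..<n}"
    using finite_same_card_bij[OF fP, of "{n - ?k..<n}"] k by auto
  obtain h where h: "bij_betw h (?V - insert c P) {1..<n - ?k}"
    using finite_same_card_bij[of "?V - insert c P" "{1..<n - ?k}"] rest by auto
  define f where "f x = (if x = c then 0 else if x \<in> P then g x else h x)" for x
  have "bij_betw f {c} {0}" by (simp add: f_def)
  moreover have fg: "bij_betw f P {n - ?k..<n}"
    using g c(3) by (subst bij_betw_cong[of P f g]) (auto simp: f_def)
  moreover have "bij_betw f (?V - insert c P) {1..<n - ?k}"
    using h by (subst bij_betw_cong[of _ f h]) (auto simp: f_def)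
  ultimately have "bij_betw f ({c} \<union> P \<union> (?V - insert c P)) ({0} \<union> {n - ?k..<n} \<union> {1..<n - ?k})"
    using k by (intro bij_betw_combine) auto
  moreover have "{c} \<union> P \<union> (?V - insert c P) = ?V" using c by auto
  moreover have "{0} \<union> {n - ?k..<n} \<union> {1..<n - ?k} = ?V" using k by auto
  ultimately have "bij_betw f ?V ?V" by simp
  moreover have "f ` P = {n - ?k..<n}" using fg by (simp add: bij_betw_def)
  moreover have "f c = 0" by (simp add: f_def)
  ultimately show ?thesis by blast
qed

text \<open>
  The structure \<open>star_of_clique\<close> determines the arcs, and it is transported along injections. An
  isomorphism is used through its inverse in one direction; in the other one it is built from the
  relabelling of \<open>star_of_clique_bij\<close>.
\<close>

lemma digraph_iso_clique_star_iff:
  assumes g: "pair_graph G" and V: "pverts G = {0..<n}" and k: "k < n"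
  shows "digraph_iso (with_proj G) (with_proj (clique_star n k))
    \<longleftrightarrow> (\<exists>c P. star_of_clique {0..<n} (parcs G) c P \<and> card P = k)"
proof
  assume "digraph_iso (with_proj G) (with_proj (clique_star n k))"
  then obtain h where h: "pre_digraph.digraph_isomorphism (with_proj G) h"
    and eq: "with_proj (clique_star n k) = app_iso h (with_proj G)"
    unfolding digraph_iso_def by blast
  define f where "f = iso_verts h"
  have inj: "inj_on f {0..<n}"
    using h V by (simp add: f_def pre_digraph.digraph_isomorphism_def)
  have fV: "f ` {0..<n} = {0..<n}"
    using arg_cong[OF eq, of verts] V by (simp add: f_def clique_star_def)
  have arcs: "parcs (clique_star n k) = iso_arcs h ` parcs G"
    and ends: "iso_tail h = fst" "iso_head h = snd"
    using arg_cong[OF eq, of arcs] arg_cong[OF eq, of tail] arg_cong[OF eq, of head] by auto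
  have arc: "iso_arcs h e = map_prod f f e" if "e \<in> parcs G" for e
    using h that ends by (auto simp: pre_digraph.digraph_isomorphism_def f_def prod_eq_iff)
  have arcs': "parcs (clique_star n k) = map_prod f f ` parcs G"
    unfolding arcs using arc by (rule image_cong[OF refl])
  define f' where "f' = the_inv_into {0..<n} f"
  have f': "f' (f x) = x" if "x \<in> {0..<n}" for x
    unfolding f'_def using inj that by (rule the_inv_into_f_f)
  have inj': "inj_on f' {0..<n}" unfolding f'_def using inj_on_the_inv_into[OF inj] fV by simp
  have f'V: "f' ` {0..<n} = {0..<n}" unfolding f'_def using the_inv_into_onto[OF inj] fV by simp
  have sub: "parcs G \<subseteq> {0..<n} \<times> {0..<n}"
    using pair_graph_arcs(1)[OF g] V by simp
  have "map_prod f' f' ` parcs (clique_star n k) = (\<lambda>e. e) ` parcs G"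
    unfolding arcs' image_image using sub f' by (intro image_cong) auto
  then have "star_of_clique {0..<n} (parcs G) (f' 0) (f' ` {n - k..<n})"
    using star_of_clique_image[OF star_of_clique_clique_star[OF k] inj'] f'V by simp
  moreover have "card (f' ` {n - k..<n}) = k"
    using inj' k by (subst card_image) (auto intro: inj_on_subset)
  ultimately show "\<exists>c P. star_of_clique {0..<n} (parcs G) c P \<and> card P = k" by blast
next
  assume "\<exists>c P. star_of_clique {0..<n} (parcs G) c P \<and> card P = k"
  then obtain c P where star: "star_of_clique {0..<n} (parcs G) c P" and card: "card P = k" by blast
  from star_of_clique_bij[OF star] obtain f where f: "bij_betw f {0..<n} {0..<n}" "f c = 0"
    "f ` P = {n - k..<n}" unfolding card by blast
  have "star_of_clique {0..<n} (map_prod f f ` parcs G) 0 {n - k..<n}"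
    using star_of_clique_image[OF star bij_betw_imp_inj_on[OF f(1)]] f(2,3) bij_betw_imp_surj_on[OF f(1)] by simp
  with star_of_clique_clique_star[OF k] have arcs: "parcs (clique_star n k) = map_prod f f ` parcs G"
    by (simp add: star_of_clique_def)
  define h where "h = \<lparr>iso_verts = f, iso_arcs = map_prod f f, iso_head = snd, iso_tail = fst\<rparr>"
  have sub: "parcs G \<subseteq> {0..<n} \<times> {0..<n}"
    using pair_graph_arcs(1)[OF g] V by simp
  have inj: "inj_on f {0..<n}" using f(1) by (rule bij_betw_imp_inj_on)
  have "wf_digraph (with_proj G)" by unfold_locales (use sub V in auto)
  moreover have "inj_on (map_prod f f) (parcs G)"
    using map_prod_inj_on[OF inj inj] sub by (rule inj_on_subset)
  ultimately have "pre_digraph.digraph_isomorphism (with_proj G) h"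
    using inj V by (simp add: pre_digraph.digraph_isomorphism_def h_def)
  moreover have "with_proj (clique_star n k) = app_iso h (with_proj G)"
    using arcs V bij_betw_imp_surj_on[OF f(1)]
    by (simp add: app_iso_def h_def with_proj_def) (simp add: clique_star_def)
  ultimately show "digraph_iso (with_proj G) (with_proj (clique_star n k))"
    unfolding digraph_iso_def by blast
qed

lemma out_degree_with_proj: "out_degree (with_proj G) i = card (parcs G `` {i})"
proof -
  have "out_arcs (with_proj G) i = Pair i ` (parcs G `` {i})"
    by (auto simp: out_arcs_def)
  then show ?thesis by (simp add: out_degree_def card_image inj_on_def)
qed

lemma kirchhoff_bound_scaled:
  assumes "n > 0"
  shows "kirchhoff_bound n k / (2 * n) = 1 / (2 * n) + (k + 1) / 2 - 1 / (n - k)"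
  using assms by (simp add: kirchhoff_bound_def add_divide_distrib diff_divide_distrib)

lemma labelled_graph_laplacian:
  assumes "pair_graph G" "pverts G = {0..<n}" "connected (with_proj G)"
  shows "labelled_graph n (parcs G) (laplacian n G)"
proof
  note G = pair_graph_arcs[OF assms(1), unfolded assms(2)]
  show "finite {0..<n}" "parcs G \<subseteq> {0..<n} \<times> {0..<n}" "(x, x) \<notin> parcs G" for x
    using G by auto
  show "(x, y) \<in> parcs G \<Longrightarrow> (y, x) \<in> parcs G" for x y
    using G(2) by (rule symD)
  show "n > 0" using connected_pair_graphD(1)[OF assms(1,3)] assms(2) by auto
  show "(i, j) \<in> (parcs G)\<^sup>*" if "i < n" "j < n" for i j
    using connected_pair_graphD(2)[OF assms(1,3)] assms(2) that by simp
  show "laplacian n G = mat n n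
      (\<lambda>(i, j). (if i = j then real (card (parcs G `` {i})) else 0) - of_bool ((i, j) \<in> parcs G))"
    by (rule eq_matI)
      (auto simp: laplacian_def degree_mat_def adjacency_mat_def out_degree_with_proj)
qed

theorem theorem12:
  fixes G :: "nat pair_pre_digraph" and n \<kappa> :: nat
  assumes "pair_graph G"
    and "pverts G = {0..<n}"
    and "connected (with_proj G)"
    and "\<kappa> = card (cut_edges G)"
  shows "rho_ss (laplacian n G)
           \<ge> 1 / (2 * real n) + (real \<kappa> + 1) / 2 - 1 / (real n - real \<kappa>)
       \<and> (rho_ss (laplacian n G)
           = 1 / (2 * real n) + (real \<kappa> + 1) / 2 - 1 / (real n - real \<kappa>)
         \<longleftrightarrow> digraph_iso (with_proj G) (with_proj (clique_star n \<kappa>)))"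
proof -
  interpret labelled_graph n "parcs G" "laplacian n G"
    using assms(1-3) by (rule labelled_graph_laplacian)
  interpret network "{0..<n}" "parcs G" by (rule network)
  have \<kappa>: "\<kappa> = card (bridges (parcs G))"
    using assms(4) cut_edges_eq_bridges[OF assms(1,3)] by simp
  have ne: "{0..<n} \<noteq> {}" using n_pos by simp
  have less: "\<kappa> < n"
    using card_bridges_less[OF simple_graph_axioms ne] \<kappa> by simp
  have rho: "rho_ss (laplacian n G) = kirchhoff {0..<n} (parcs G) / (2 * n)"
    using sum_inverse_eigval carrier_matD(1)[OF L_carrier] by (simp add: rho_ss_def)
  have bound: "1 / (2 * real n) + (real \<kappa> + 1) / 2 - 1 / (real n - real \<kappa>)
      = kirchhoff_bound n \<kappa> / (2 * n)"
    using kirchhoff_bound_scaled[of "real n" "real \<kappa>"] n_pos by simp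
  note lower = kirchhoff_lower_bound[OF network_axioms ne, folded \<kappa>]
  have "kirchhoff {0..<n} (parcs G) = kirchhoff_bound n \<kappa>
      \<longleftrightarrow> (\<exists>c P. star_of_clique {0..<n} (parcs G) c P \<and> card P = \<kappa>)"
    using lower star_of_clique_values[OF network_axioms] by auto
  then show ?thesis
    unfolding rho bound digraph_iso_clique_star_iff[OF assms(1,2) less]
    using lower n_pos by (simp add: divide_right_mono)
qed

end
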